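(* Let $I=[0,1]$ or $I=[0,\infty)$. For every $1\le p<\infty$ the Cesàro function space $Ces_p(I)$ has the weak Banach-Saks property.
   Context: For $1\le p<\infty$, the Cesàro function space $Ces_p(I)$ is the space of all (classes, modulo equality almost everywhere, of) Lebesgue measurable real functions $f$ on $I$ such that $$\|f\|_{C(p)}=\left[\int_I\left(\frac1x\int_0^x|f(t)|\,dt\right)^p dx\right]^{1/p}<\infty,$$ equipped with the norm $\|\cdot\|_{C(p)}$; it is a Banach space. A Banach space $X$ has the weak Banach-Saks property if every weakly null sequence $(x_n)$ in $X$ contains a subsequence $(x_{n_k})$ such that $\lim_{m\to\infty}\frac1m\left\|\sum_{k=1}^m x_{n_k}\right\|_X=0$. *)

theory Defs
  imports "HOL-Analysis.Analysis"
begin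

text \<open>
  The function space considered depends on a real exponent \<open>p\<close>, so it cannot be a type of class
  \<open>real_normed_vector\<close>. Normed spaces are therefore given by an explicit carrier and operations.
\<close>

record 'a normed_structure =
  ns_carrier :: "'a set"
  ns_zero :: 'a
  ns_add :: "'a \<Rightarrow> 'a \<Rightarrow> 'a"
  ns_scale :: "real \<Rightarrow> 'a \<Rightarrow> 'a"
  ns_norm :: "'a \<Rightarrow> real"

primrec ns_sum :: "('a, 'm) normed_structure_scheme \<Rightarrow> (nat \<Rightarrow> 'a) \<Rightarrow> nat \<Rightarrow> 'a" where
  "ns_sum X x 0 = ns_zero X"
| "ns_sum X x (Suc m) = ns_add X (ns_sum X x m) (x m)"

definition ns_dual :: "('a, 'm) normed_structure_scheme \<Rightarrow> ('a \<Rightarrow> real) set" where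
  "ns_dual X = {\<phi>.
     (\<forall>u\<in>ns_carrier X. \<forall>v\<in>ns_carrier X. \<phi> (ns_add X u v) = \<phi> u + \<phi> v) \<and>
     (\<forall>c. \<forall>u\<in>ns_carrier X. \<phi> (ns_scale X c u) = c * \<phi> u) \<and>
     (\<exists>C. \<forall>u\<in>ns_carrier X. \<bar>\<phi> u\<bar> \<le> C * ns_norm X u)}"

definition weakly_null :: "('a, 'm) normed_structure_scheme \<Rightarrow> (nat \<Rightarrow> 'a) \<Rightarrow> bool" where
  "weakly_null X x \<longleftrightarrow>
     (\<forall>n. x n \<in> ns_carrier X) \<and> (\<forall>\<phi>\<in>ns_dual X. (\<lambda>n. \<phi> (x n)) \<longlonglongrightarrow> 0)"

definition weak_banach_saks :: "('a, 'm) normed_structure_scheme \<Rightarrow> bool" where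
  "weak_banach_saks X \<longleftrightarrow>
     (\<forall>x. weakly_null X x \<longrightarrow>
        (\<exists>r. strict_mono r \<and>
           (\<lambda>m. 1 / real m * ns_norm X (ns_sum X (\<lambda>k. x (r k)) m)) \<longlonglongrightarrow> 0))"

definition ennreal_powr :: "ennreal \<Rightarrow> real \<Rightarrow> ennreal" where
  "ennreal_powr a p = (if a = \<infinity> then \<infinity> else ennreal (enn2real a powr p))"

definition cesaro_mean :: "(real \<Rightarrow> real) \<Rightarrow> real \<Rightarrow> ennreal" where
  "cesaro_mean f x = (\<integral>\<^sup>+t\<in>{0..x}. ennreal \<bar>f t\<bar> \<partial>lebesgue) / ennreal x"

definition cesaro_norm :: "real \<Rightarrow> real set \<Rightarrow> (real \<Rightarrow> real) \<Rightarrow> ennreal" where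
  "cesaro_norm p I f =
     ennreal_powr (\<integral>\<^sup>+x\<in>I. ennreal_powr (cesaro_mean f x) p \<partial>lebesgue) (1 / p)"

definition cesaro_functions :: "real \<Rightarrow> real set \<Rightarrow> (real \<Rightarrow> real) set" where
  "cesaro_functions p I = {f \<in> borel_measurable (lebesgue_on I). cesaro_norm p I f < \<infinity>}"

text \<open>
  A function on \<open>I\<close> is represented by functions on all of \<open>real\<close>; their values outside \<open>I\<close> are
  irrelevant and are identified by the relation below.
\<close>

definition cesaro_rel :: "real \<Rightarrow> real set \<Rightarrow> ((real \<Rightarrow> real) \<times> (real \<Rightarrow> real)) set" where
  "cesaro_rel p I = {(f, g). f \<in> cesaro_functions p I \<and> g \<in> cesaro_functions p I \<and>
     (AE x in lebesgue_on I. f x = g x)}"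

definition Ces :: "real \<Rightarrow> real set \<Rightarrow> (real \<Rightarrow> real) set normed_structure" where
  "Ces p I = \<lparr>
     ns_carrier = cesaro_functions p I // cesaro_rel p I,
     ns_zero = cesaro_rel p I `` {\<lambda>x. 0},
     ns_add = (\<lambda>A B. \<Union>f\<in>A. \<Union>g\<in>B. cesaro_rel p I `` {\<lambda>x. f x + g x}),
     ns_scale = (\<lambda>c A. \<Union>f\<in>A. cesaro_rel p I `` {\<lambda>x. c * f x}),
     ns_norm = (\<lambda>A. the_elem ((\<lambda>f. enn2real (cesaro_norm p I f)) ` A)) \<rparr>"

text \<open>
  The operations of \<open>Ces p I\<close> are well defined: \<open>cesaro_functions p I\<close> is closed under the linear
  operations, and sums, multiples and norms of classes are computed on arbitrary representatives.
\<close>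

lemma ennreal_powr_mono:
  assumes "a \<le> b" "0 \<le> p"
  shows "ennreal_powr a p \<le> ennreal_powr b p"
proof (cases "b = \<infinity>")
  case False
  then have "a \<noteq> \<infinity>"
    using assms(1) by (auto simp: top_unique)
  moreover have "enn2real a \<le> enn2real b"
    using False assms(1) by (intro enn2real_mono) (auto simp: less_top)
  ultimately show ?thesis
    using False assms(2) by (simp add: ennreal_powr_def ennreal_leI powr_mono2)
qed (simp add: ennreal_powr_def)

lemma ennreal_powr_less_top: "ennreal_powr a p < \<infinity> \<longleftrightarrow> a < \<infinity>"
  by (simp add: ennreal_powr_def less_top)

lemma ennreal_powr_add_le:
  assumes "1 \<le> p"
  shows "ennreal_powr (a + b) p \<le> ennreal (2 powr p) * (ennreal_powr a p + ennreal_powr b p)"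
proof (cases "a = \<infinity> \<or> b = \<infinity>")
  case True
  then show ?thesis
    by (auto simp: ennreal_powr_def ennreal_mult_top)
next
  case False
  define s t where "s = enn2real a" and "t = enn2real b"
  have ab: "a = ennreal s" "b = ennreal t" and st: "0 \<le> s" "0 \<le> t"
    using False by (simp_all add: s_def t_def less_top)
  have "(s + t) powr p \<le> (2 * max s t) powr p"
    using st assms by (intro powr_mono2) auto
  also have "\<dots> = 2 powr p * max s t powr p"
    using st by (simp add: powr_mult)
  also have "\<dots> \<le> 2 powr p * (s powr p + t powr p)"
    by (intro mult_left_mono) (auto simp: max_def)
  finally show ?thesis
    using st by (simp add: ab ennreal_powr_def flip: ennreal_plus ennreal_mult)
qed

lemma AE_lebesgue_on_interval:
  fixes x :: real
  assumes "AE t in lebesgue_on I. P t" and "I = {0..1} \<or> I = {0..}" and "x \<in> I"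
  shows "AE t in lebesgue. t \<in> {0..x} \<longrightarrow> P t"
proof -
  have "I \<in> sets lebesgue" and sub: "{0..x} \<subseteq> I"
    using assms(2,3) by auto
  then have "AE t in lebesgue. t \<in> I \<longrightarrow> P t"
    using assms(1) by (simp add: AE_restrict_space_iff)
  then show ?thesis
    by eventually_elim (use sub in blast)
qed

lemma cesaro_mean_mono_AE:
  assumes "AE t in lebesgue_on I. \<bar>f t\<bar> \<le> \<bar>g t\<bar>" and "I = {0..1} \<or> I = {0..}" and "x \<in> I"
  shows "cesaro_mean f x \<le> cesaro_mean g x"
proof -
  have "AE t in lebesgue. ennreal \<bar>f t\<bar> * indicator {0..x} t \<le> ennreal \<bar>g t\<bar> * indicator {0..x} t"
    using AE_lebesgue_on_interval[OF assms]
    by eventually_elim (auto simp: indicator_def ennreal_leI)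
  then show ?thesis
    unfolding cesaro_mean_def by (intro divide_right_mono_ennreal nn_integral_mono_AE)
qed

lemma cesaro_norm_mono_AE:
  assumes "AE t in lebesgue_on I. \<bar>f t\<bar> \<le> \<bar>g t\<bar>" and "I = {0..1} \<or> I = {0..}" and "1 \<le> p"
  shows "cesaro_norm p I f \<le> cesaro_norm p I g"
proof -
  have "ennreal_powr (cesaro_mean f x) p * indicator I x \<le>
      ennreal_powr (cesaro_mean g x) p * indicator I x" for x
    using assms(3) cesaro_mean_mono_AE[OF assms(1,2)]
    by (cases "x \<in> I") (auto intro: ennreal_powr_mono)
  then show ?thesis
    unfolding cesaro_norm_def using assms(3)
    by (intro ennreal_powr_mono nn_integral_mono) auto
qed

lemma cesaro_norm_cong_AE:
  assumes "AE t in lebesgue_on I. f t = g t" and "I = {0..1} \<or> I = {0..}" and "1 \<le> p"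
  shows "cesaro_norm p I f = cesaro_norm p I g"
proof -
  have "AE t in lebesgue_on I. \<bar>f t\<bar> \<le> \<bar>g t\<bar>" "AE t in lebesgue_on I. \<bar>g t\<bar> \<le> \<bar>f t\<bar>"
    using assms(1) by (eventually_elim, simp)+
  then show ?thesis
    using assms(2,3) by (intro antisym cesaro_norm_mono_AE)
qed

lemma indicator_measurable_aux:
  fixes f :: "real \<Rightarrow> real"
  assumes f: "f \<in> borel_measurable (lebesgue_on I)" and "I = {0..1} \<or> I = {0..}" and "x \<in> I"
  shows "(\<lambda>t. ennreal \<bar>f t\<bar> * indicator {0..x} t) \<in> borel_measurable lebesgue"
proof -
  have "{0..x} \<subseteq> I"
    using assms(2,3) by (auto intro: order_trans)
  then have "f \<in> borel_measurable (lebesgue_on {0..x})"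
    using f by (rule measurable_restrict_mono[rotated])
  then have "(\<lambda>t. ennreal \<bar>f t\<bar>) \<in> borel_measurable (lebesgue_on {0..x})"
    by simp
  then show ?thesis
    by (subst (asm) borel_measurable_restrict_space_iff_ennreal) auto
qed

lemma cesaro_mean_add:
  assumes "f \<in> borel_measurable (lebesgue_on I)" "g \<in> borel_measurable (lebesgue_on I)"
    and "I = {0..1} \<or> I = {0..}" and "x \<in> I"
  shows "cesaro_mean (\<lambda>t. f t + g t) x \<le> cesaro_mean f x + cesaro_mean g x"
proof -
  have "ennreal \<bar>f t + g t\<bar> \<le> ennreal \<bar>f t\<bar> + ennreal \<bar>g t\<bar>" for t
    by (simp flip: ennreal_plus)
  then have "(\<integral>\<^sup>+t\<in>{0..x}. ennreal \<bar>f t + g t\<bar> \<partial>lebesgue) \<le>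
      (\<integral>\<^sup>+t. ennreal \<bar>f t\<bar> * indicator {0..x} t + ennreal \<bar>g t\<bar> * indicator {0..x} t \<partial>lebesgue)"
    by (intro nn_integral_mono) (auto simp: indicator_def)
  also have "\<dots> = (\<integral>\<^sup>+t\<in>{0..x}. ennreal \<bar>f t\<bar> \<partial>lebesgue) + (\<integral>\<^sup>+t\<in>{0..x}. ennreal \<bar>g t\<bar> \<partial>lebesgue)"
    using assms by (intro nn_integral_add indicator_measurable_aux)
  finally show ?thesis
    unfolding cesaro_mean_def add_divide_distrib_ennreal[symmetric]
    by (rule divide_right_mono_ennreal)
qed

lemma mono_cesaro_integral: "mono (\<lambda>x. \<integral>\<^sup>+t\<in>{0..x}. ennreal \<bar>f t\<bar> \<partial>lebesgue)"
  by (intro monoI nn_integral_mono mult_left_mono) (auto simp: indicator_def)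

lemma borel_measurable_ennreal_powr [measurable (raw)]:
  assumes [measurable]: "f \<in> borel_measurable M"
  shows "(\<lambda>x. ennreal_powr (f x) p) \<in> borel_measurable M"
  unfolding ennreal_powr_def infinity_ennreal_def by measurable

lemma borel_measurable_cesaro_mean: "cesaro_mean f \<in> borel_measurable lebesgue"
proof -
  have "(\<lambda>x. \<integral>\<^sup>+t\<in>{0..x}. ennreal \<bar>f t\<bar> \<partial>lebesgue) \<in> borel_measurable borel"
  proof (rule borel_measurableI_greater)
    fix y
    have "is_interval {x. y < (\<integral>\<^sup>+t\<in>{0..x}. ennreal \<bar>f t\<bar> \<partial>lebesgue)}"
      using monoD[OF mono_cesaro_integral[of f]] by (auto simp: is_interval_1 intro: less_le_trans)
    then show "{x \<in> space borel. y < (\<integral>\<^sup>+t\<in>{0..x}. ennreal \<bar>f t\<bar> \<partial>lebesgue)} \<in> sets borel"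
      by (simp add: real_interval_borel_measurable)
  qed
  then have "cesaro_mean f \<in> borel_measurable lborel"
    unfolding cesaro_mean_def[abs_def] by measurable
  then show ?thesis
    by (rule measurable_completion)
qed

lemma cesaro_functions_zero: "0 < p \<Longrightarrow> (\<lambda>x. 0) \<in> cesaro_functions p I"
  by (simp add: cesaro_functions_def cesaro_norm_def cesaro_mean_def ennreal_powr_def)

lemma cesaro_functions_add:
  assumes "f \<in> cesaro_functions p I" "g \<in> cesaro_functions p I"
    and I: "I = {0..1} \<or> I = {0..}" and p: "1 \<le> p"
  shows "(\<lambda>x. f x + g x) \<in> cesaro_functions p I"
proof -
  let ?A = "\<lambda>f x. ennreal_powr (cesaro_mean f x) p * indicator I x"
  have meas: "f \<in> borel_measurable (lebesgue_on I)" "g \<in> borel_measurable (lebesgue_on I)"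
    and fin: "(\<integral>\<^sup>+x. ?A f x \<partial>lebesgue) < \<infinity>" "(\<integral>\<^sup>+x. ?A g x \<partial>lebesgue) < \<infinity>"
    using assms(1,2) by (simp_all only: cesaro_functions_def cesaro_norm_def ennreal_powr_less_top mem_Collect_eq)
  have "I \<in> sets lebesgue"
    using I by auto
  then have A: "?A h \<in> borel_measurable lebesgue" for h
    using borel_measurable_cesaro_mean[of h]
    by (intro borel_measurable_times_ennreal borel_measurable_ennreal_powr borel_measurable_indicator)
  have "?A (\<lambda>x. f x + g x) x \<le> ennreal (2 powr p) * (?A f x + ?A g x)" for x
  proof (cases "x \<in> I")
    case True
    have "ennreal_powr (cesaro_mean (\<lambda>x. f x + g x) x) p \<le>
        ennreal_powr (cesaro_mean f x + cesaro_mean g x) p"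
      using cesaro_mean_add[OF meas I True] p by (intro ennreal_powr_mono) auto
    also have "\<dots> \<le> ennreal (2 powr p) * (ennreal_powr (cesaro_mean f x) p + ennreal_powr (cesaro_mean g x) p)"
      by (rule ennreal_powr_add_le[OF p])
    finally show ?thesis
      using True by simp
  qed simp
  then have "(\<integral>\<^sup>+x. ?A (\<lambda>x. f x + g x) x \<partial>lebesgue) \<le>
      (\<integral>\<^sup>+x. ennreal (2 powr p) * (?A f x + ?A g x) \<partial>lebesgue)"
    by (intro nn_integral_mono)
  also have "\<dots> = ennreal (2 powr p) * ((\<integral>\<^sup>+x. ?A f x \<partial>lebesgue) + (\<integral>\<^sup>+x. ?A g x \<partial>lebesgue))"
    by (simp only: nn_integral_cmult[OF borel_measurable_add[OF A A]] nn_integral_add[OF A A])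
  also have "\<dots> < \<infinity>"
    using fin by (simp add: ennreal_mult_less_top)
  finally have "cesaro_norm p I (\<lambda>x. f x + g x) < \<infinity>"
    by (simp only: cesaro_norm_def ennreal_powr_less_top)
  then show ?thesis
    using meas by (simp add: cesaro_functions_def)
qed

lemma cesaro_norm_scale:
  assumes "f \<in> borel_measurable (lebesgue_on I)" and I: "I = {0..1} \<or> I = {0..}" and p: "1 \<le> p"
  shows "cesaro_norm p I (\<lambda>x. c * f x) = ennreal \<bar>c\<bar> * cesaro_norm p I f"
proof -
  have powr: "ennreal_powr (ennreal d * a) q = ennreal (d powr q) * ennreal_powr a q"
    if "0 \<le> d" "0 < q" for d q a
  proof (cases "d = 0")
    case False
    show ?thesis
    proof (cases a)
      case (real r)
      then show ?thesis
        using that by (simp add: ennreal_powr_def powr_mult flip: ennreal_mult)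
    next
      case top
      then show ?thesis
        using that False by (simp add: ennreal_powr_def ennreal_mult_top)
    qed
  qed (use that in \<open>simp add: ennreal_powr_def\<close>)
  have mean: "cesaro_mean (\<lambda>x. c * f x) x = ennreal \<bar>c\<bar> * cesaro_mean f x" if "x \<in> I" for x
  proof -
    have "(\<integral>\<^sup>+t\<in>{0..x}. ennreal \<bar>c * f t\<bar> \<partial>lebesgue) =
        (\<integral>\<^sup>+t. ennreal \<bar>c\<bar> * (ennreal \<bar>f t\<bar> * indicator {0..x} t) \<partial>lebesgue)"
      by (simp add: abs_mult ennreal_mult mult.assoc)
    also have "\<dots> = ennreal \<bar>c\<bar> * (\<integral>\<^sup>+t\<in>{0..x}. ennreal \<bar>f t\<bar> \<partial>lebesgue)"
      by (rule nn_integral_cmult[OF indicator_measurable_aux[OF assms(1) I that]])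
    finally show ?thesis
      by (simp only: cesaro_mean_def ennreal_times_divide)
  qed
  have "I \<in> sets lebesgue"
    using I by auto
  then have meas: "(\<lambda>x. ennreal_powr (cesaro_mean f x) p * indicator I x) \<in> borel_measurable lebesgue"
    using borel_measurable_cesaro_mean[of f]
    by (intro borel_measurable_times_ennreal borel_measurable_ennreal_powr borel_measurable_indicator)
  have eq: "ennreal_powr (cesaro_mean (\<lambda>x. c * f x) x) p * indicator I x =
      ennreal (\<bar>c\<bar> powr p) * (ennreal_powr (cesaro_mean f x) p * indicator I x)" for x
    using p by (cases "x \<in> I") (simp_all add: mean powr)
  have zero_less: "0 < 1 / p" and c: "(\<bar>c\<bar> powr p) powr (1 / p) = \<bar>c\<bar>"
    using p by (simp_all add: powr_powr)
  show ?thesis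
    unfolding cesaro_norm_def eq nn_integral_cmult[OF meas]
    by (simp only: powr[OF powr_ge_zero zero_less] c)
qed

lemma cesaro_functions_scale:
  assumes "f \<in> cesaro_functions p I" and "I = {0..1} \<or> I = {0..}" and "1 \<le> p"
  shows "(\<lambda>x. c * f x) \<in> cesaro_functions p I"
  using assms by (auto simp: cesaro_functions_def cesaro_norm_scale ennreal_mult_less_top)

lemma equiv_cesaro_rel: "equiv (cesaro_functions p I) (cesaro_rel p I)"
proof (rule equivI)
  show "sym (cesaro_rel p I)"
    by (auto simp: cesaro_rel_def eq_commute intro!: symI)
  show "trans (cesaro_rel p I)"
  proof (rule transI)
    fix f g h assume "(f, g) \<in> cesaro_rel p I" "(g, h) \<in> cesaro_rel p I"
    then have *: "f \<in> cesaro_functions p I" "h \<in> cesaro_functions p I"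
        "AE x in lebesgue_on I. f x = g x" "AE x in lebesgue_on I. g x = h x"
      by (auto simp: cesaro_rel_def)
    have "AE x in lebesgue_on I. f x = h x"
      using *(3,4) by eventually_elim simp
    with * show "(f, h) \<in> cesaro_rel p I"
      by (simp add: cesaro_rel_def)
  qed
qed (auto simp: cesaro_rel_def refl_on_def)

lemma Ces_carrier_iff:
  "A \<in> ns_carrier (Ces p I) \<longleftrightarrow> (\<exists>f\<in>cesaro_functions p I. A = cesaro_rel p I `` {f})"
  by (auto simp: Ces_def quotient_def)

lemma Ces_norm_class:
  assumes "f \<in> cesaro_functions p I" and "I = {0..1} \<or> I = {0..}" and "1 \<le> p"
  shows "ns_norm (Ces p I) (cesaro_rel p I `` {f}) = enn2real (cesaro_norm p I f)"
proof -
  have "cesaro_norm p I g = cesaro_norm p I f" if "g \<in> cesaro_rel p I `` {f}" for g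
  proof -
    have "AE x in lebesgue_on I. f x = g x"
      using that by (simp add: cesaro_rel_def)
    from cesaro_norm_cong_AE[OF this assms(2,3)] show ?thesis
      by (rule sym)
  qed
  moreover have "f \<in> cesaro_rel p I `` {f}"
    using assms(1) by (simp add: cesaro_rel_def)
  ultimately have "(\<lambda>f. enn2real (cesaro_norm p I f)) ` (cesaro_rel p I `` {f}) =
      {enn2real (cesaro_norm p I f)}"
    by (metis (no_types, lifting) image_cong image_constant)
  then show ?thesis
    by (simp add: Ces_def)
qed

lemma Ces_add_class:
  assumes "f \<in> cesaro_functions p I" "g \<in> cesaro_functions p I"
    and "I = {0..1} \<or> I = {0..}" and "1 \<le> p"
  shows "ns_add (Ces p I) (cesaro_rel p I `` {f}) (cesaro_rel p I `` {g}) =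
    cesaro_rel p I `` {\<lambda>x. f x + g x}"
proof -
  have "congruent2 (cesaro_rel p I) (cesaro_rel p I) (\<lambda>f g. cesaro_rel p I `` {\<lambda>x. f x + g x})"
  proof (rule congruent2I')
    fix f f' g g' assume *: "(f, f') \<in> cesaro_rel p I" "(g, g') \<in> cesaro_rel p I"
    then have "AE x in lebesgue_on I. f x = f' x" "AE x in lebesgue_on I. g x = g' x"
      by (simp_all add: cesaro_rel_def)
    then have "AE x in lebesgue_on I. f x + g x = f' x + g' x"
      by eventually_elim simp
    then have "((\<lambda>x. f x + g x), (\<lambda>x. f' x + g' x)) \<in> cesaro_rel p I"
      using * assms(3,4) by (simp add: cesaro_rel_def cesaro_functions_add)
    then show "cesaro_rel p I `` {\<lambda>x. f x + g x} = cesaro_rel p I `` {\<lambda>x. f' x + g' x}"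
      by (rule equiv_class_eq[OF equiv_cesaro_rel])
  qed
  from UN_equiv_class2[OF equiv_cesaro_rel equiv_cesaro_rel this assms(1,2)] show ?thesis
    by (simp add: Ces_def)
qed

lemma Ces_scale_class:
  assumes "f \<in> cesaro_functions p I" and "I = {0..1} \<or> I = {0..}" and "1 \<le> p"
  shows "ns_scale (Ces p I) c (cesaro_rel p I `` {f}) = cesaro_rel p I `` {\<lambda>x. c * f x}"
proof -
  have "congruent (cesaro_rel p I) (\<lambda>f. cesaro_rel p I `` {\<lambda>x. c * f x})"
  proof (rule congruentI)
    fix f f' assume *: "(f, f') \<in> cesaro_rel p I"
    then have "AE x in lebesgue_on I. f x = f' x"
      by (simp add: cesaro_rel_def)
    then have "AE x in lebesgue_on I. c * f x = c * f' x"
      by eventually_elim simp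
    then have "((\<lambda>x. c * f x), (\<lambda>x. c * f' x)) \<in> cesaro_rel p I"
      using * assms(2,3) by (simp add: cesaro_rel_def cesaro_functions_scale)
    then show "cesaro_rel p I `` {\<lambda>x. c * f x} = cesaro_rel p I `` {\<lambda>x. c * f' x}"
      by (rule equiv_class_eq[OF equiv_cesaro_rel])
  qed
  from UN_equiv_class[OF equiv_cesaro_rel this assms(1)] show ?thesis
    by (simp add: Ces_def)
qed

end

theory Submission
  imports Defs
begin

text \<open>
  Let \<open>f n\<close> be weakly null. Testing against bounded functions shows that the restrictions of
  \<open>f n\<close> to \<open>[0, b]\<close>, \<open>b\<close> interior to \<open>I\<close>, are bounded, uniformly integrable and weakly null in \<open>L\<^sub>1\<close>. Choosing
  the subsequence so that the derivative of a Huber function at the current partial sum is almost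
  orthogonal to the next term makes the means tend to \<open>0\<close> in \<open>L\<^sub>1(0, b)\<close> (Szlenk's theorem). For
  \<open>p = 1\<close> the Cesaro norm is a weighted \<open>L\<^sub>1\<close> norm by Tonelli, and this is all.

  For \<open>p > 1\<close> pass first to a subsequence along which \<open>\<integral>\<^sub>0\<^sup>x \<bar>f n\<bar>\<close> converges for all \<open>x\<close>, so that the
  averages \<open>A n\<close> of \<open>\<bar>f n\<bar>\<close> converge pointwise to some \<open>A\<close> in \<open>L\<^sub>p\<close>. The excesses \<open>D n = (A n - A)\<^sup>+\<close> are bounded
  in \<open>L\<^sub>p\<close> and tend to \<open>0\<close> pointwise, so the next term can be chosen almost disjoint from the
  previous sum, whence \<open>\<parallel>\<Sum>k<m. D k\<parallel>\<^sub>p = O(m\<^bsup>1/p\<^esup>) = o(m)\<close>. The average of the absolute value of the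
  mean is dominated by \<open>A\<close> plus the mean of the \<open>D k\<close>, and it tends to \<open>0\<close> pointwise by the \<open>L\<^sub>1\<close> case;
  dominated convergence finishes the proof.
\<close>

section \<open>Weakly null sequences and selection of subsequences\<close>

text \<open>The norm sees only averages of |f|, and passing from f to |f| is not linear: for weakly
  null \<open>f n\<close> the averages of |f n| need not tend to 0, so their limit \<open>A\<close>
  may be nonzero. All cancellation has to come from the signed sums in L_1 on the intervals
  \<open>[0, b]\<close>; what escapes from there is a question of size only and is controlled by
  \<open>A\<close> and the excesses over it. At p = 1 the bound O(m^(1/p)) gains nothing over m, so
  that case has to be an L_1 statement as a whole. The norm of L_1 is not smooth, which rules out a
  direct expansion of the norm of a sum. The Huber function at level K has curvature at most 1 and,
  divided by K, differs from |t| by at most K/2. The cutoff L for uniform integrability is fixed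
  before K, so the error per step, of order (1 + L B) / K, can be made small. Boundedness of the
  sequence is not part of weak nullness; it is derived from explicit norming functionals, obtained
  by applying the transpose of the averaging operator to the norming functions of L_p.\<close>

lemma strict_mono_selection:
  fixes Q :: "nat list \<Rightarrow> nat \<Rightarrow> bool"
  assumes freq: "\<And>xs. \<exists>\<^sub>F n in sequentially. Q xs n"
  obtains r where "strict_mono r" "\<And>k. Q (map r [0..<k]) (r k)"
proof -
  define g where "g xs = (SOME n. Q xs n \<and> (\<forall>i\<in>set xs. i < n))" for xs
  have g: "Q xs (g xs) \<and> (\<forall>i\<in>set xs. i < g xs)" for xs
  proof -
    obtain n where "Q xs n" "Suc (Max (insert 0 (set xs))) \<le> n"
      using freq[of xs] unfolding frequently_sequentially by blast
    then have "\<exists>n. Q xs n \<and> (\<forall>i\<in>set xs. i < n)"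
      by (intro exI[of _ n]) (auto simp: Suc_le_eq)
    then show ?thesis
      unfolding g_def by (rule someI_ex)
  qed
  \<comment> \<open>The recursion carries the list of all earlier choices, since \<open>Q\<close>
    will express conditions on the next term relative to the whole partial sum.\<close>
  define ys where "ys = rec_nat [] (\<lambda>_ xs. xs @ [g xs])"
  have ys: "ys 0 = []" "\<And>k. ys (Suc k) = ys k @ [g (ys k)]"
    by (simp_all add: ys_def)
  define r where "r k = g (ys k)" for k
  have map: "ys k = map r [0..<k]" for k
    by (induction k) (simp_all add: ys r_def)
  show ?thesis
  proof
    show "strict_mono r"
      unfolding strict_mono_Suc_iff
    proof
      fix k
      have "r k \<in> set (ys (Suc k))"
        by (simp add: ys r_def)
      then show "r k < r (Suc k)"
        using g[of "ys (Suc k)"] by (simp add: r_def)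
    qed
    show "Q (map r [0..<k]) (r k)" for k
      using g[of "ys k"] by (simp add: r_def flip: map)
  qed
qed

lemma weakly_null_subseq:
  "weakly_null X x \<Longrightarrow> strict_mono s \<Longrightarrow> weakly_null X (\<lambda>n. x (s n))"
  unfolding weakly_null_def using LIMSEQ_subseq_LIMSEQ by (fastforce simp: o_def)

text \<open>
  Uniform boundedness by signs: in \<open>\<Sum>k. \<plusminus> \<psi> k / 3 ^ k\<close> the sign of the \<open>k\<close>-th term is chosen so that the
  partial sum is at least \<open>\<psi> k / 3 ^ k\<close> in absolute value at \<open>x (\<nu> k)\<close>; the remaining terms
  contribute at most half of that.
\<close>

lemma weakly_null_imp_norm_bounded:
  fixes X :: "('a, 'm) normed_structure_scheme"
  assumes x: "weakly_null X x"
    and norming: "\<And>u. u \<in> ns_carrier X \<Longrightarrow>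
      \<exists>\<psi>\<in>ns_dual X. \<psi> u = ns_norm X u \<and> (\<forall>v\<in>ns_carrier X. \<bar>\<psi> v\<bar> \<le> ns_norm X v)"
  obtains M where "\<And>n. ns_norm X (x n) \<le> M"
proof (rule ccontr)
  assume "\<not> thesis"
  then have "\<exists>n. ns_norm X (x n) > M" for M
    using that by (meson not_le)
  \<comment> \<open>The k-th functional enters the series with coefficient 3 ^ - k, and the tail can
    destroy half of its value at \<open>x (\<nu> k)\<close>. The factor 2 * 3 ^ k compensates for
    both, leaving at least k.\<close>
  then have "\<forall>k. \<exists>n. ns_norm X (x n) > 2 * 3 ^ k * real k"
    by blast
  from choice[OF this] obtain \<nu> where \<nu>: "\<And>k. ns_norm X (x (\<nu> k)) > 2 * 3 ^ k * real k"
    by blast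
  have xc: "x n \<in> ns_carrier X" for n
    using x by (simp add: weakly_null_def)
  have "\<forall>k. \<exists>\<psi>. \<psi> \<in> ns_dual X \<and> \<psi> (x (\<nu> k)) = ns_norm X (x (\<nu> k)) \<and>
      (\<forall>v\<in>ns_carrier X. \<bar>\<psi> v\<bar> \<le> ns_norm X v)"
    using norming[OF xc] by blast
  from choice[OF this] obtain \<psi> where "\<forall>k. \<psi> k \<in> ns_dual X \<and> \<psi> k (x (\<nu> k)) = ns_norm X (x (\<nu> k)) \<and>
      (\<forall>v\<in>ns_carrier X. \<bar>\<psi> k v\<bar> \<le> ns_norm X v)" ..
  then have \<psi>: "\<And>k. \<psi> k \<in> ns_dual X" "\<And>k. \<psi> k (x (\<nu> k)) = ns_norm X (x (\<nu> k))"
      "\<And>k v. v \<in> ns_carrier X \<Longrightarrow> \<bar>\<psi> k v\<bar> \<le> ns_norm X v"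
    by blast+
  define step where "step k \<phi> = (if \<bar>\<phi> (x (\<nu> k)) + \<psi> k (x (\<nu> k)) / 3 ^ k\<bar> \<ge> ns_norm X (x (\<nu> k)) / 3 ^ k
     then 1 else - 1 :: real)" for k and \<phi> :: "'a \<Rightarrow> real"
  define \<Phi> where "\<Phi> = rec_nat (\<lambda>u. 0) (\<lambda>k \<phi> u. \<phi> u + step k \<phi> * \<psi> k u / 3 ^ k)"
  define s where "s k = step k (\<Phi> k)" for k
  have \<Phi>: "\<Phi> 0 u = 0" "\<Phi> (Suc k) u = \<Phi> k u + s k * \<psi> k u / 3 ^ k" for k u
    by (simp_all add: \<Phi>_def s_def)
  have sum: "\<Phi> k u = (\<Sum>i<k. s i * \<psi> i u / 3 ^ i)" for k u
    by (induction k) (simp_all add: \<Phi>)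
  have s1: "\<bar>s k\<bar> = 1" for k
    by (simp add: s_def step_def)
  have bound: "\<bar>s i * \<psi> i u / 3 ^ i\<bar> \<le> ns_norm X u * (1/3) ^ i" if "u \<in> ns_carrier X" for i u
    using \<psi>(3)[OF that, of i] by (simp add: abs_mult s1 power_one_over divide_right_mono divide_simps)
  define \<phi> where "\<phi> u = (\<Sum>i. s i * \<psi> i u / 3 ^ i)" for u
  have geo: "summable (\<lambda>i. ns_norm X u * (1/3::real) ^ i)" for u
    by (intro summable_mult summable_geometric) auto
  have summ: "summable (\<lambda>i. s i * \<psi> i u / 3 ^ i)" if "u \<in> ns_carrier X" for u
    by (rule summable_comparison_test'[OF geo[of u], of 0]) (unfold real_norm_def, rule bound[OF that])
  have "\<phi> \<in> ns_dual X"
  proof -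
    have lin: "\<psi> i (ns_add X u v) = \<psi> i u + \<psi> i v" if "u \<in> ns_carrier X" "v \<in> ns_carrier X" for i u v
      using \<psi>(1)[of i] that by (simp add: ns_dual_def)
    have sc: "\<psi> i (ns_scale X c u) = c * \<psi> i u" if "u \<in> ns_carrier X" for i c u
      using \<psi>(1)[of i] that by (simp add: ns_dual_def)
    have "\<phi> (ns_add X u v) = \<phi> u + \<phi> v" if u: "u \<in> ns_carrier X" and v: "v \<in> ns_carrier X" for u v
      unfolding \<phi>_def using suminf_add[OF summ[OF u] summ[OF v]]
      by (simp add: lin[OF u v] algebra_simps add_divide_distrib)
    moreover have "\<phi> (ns_scale X c u) = c * \<phi> u" if u: "u \<in> ns_carrier X" for c u
      unfolding \<phi>_def using suminf_mult[OF summ[OF u], of c]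
      by (simp add: sc[OF u] algebra_simps)
    moreover have "\<bar>\<phi> u\<bar> \<le> (3/2) * ns_norm X u" if u: "u \<in> ns_carrier X" for u
    proof -
      have a: "summable (\<lambda>i. \<bar>s i * \<psi> i u / 3 ^ i\<bar>)"
        by (rule summable_comparison_test'[OF geo[of u], of 0])
          (unfold real_norm_def abs_idempotent, rule bound[OF u])
      have "\<bar>\<phi> u\<bar> \<le> (\<Sum>i. \<bar>s i * \<psi> i u / 3 ^ i\<bar>)"
        unfolding \<phi>_def by (rule summable_rabs[OF a])
      also have "\<dots> \<le> (\<Sum>i. ns_norm X u * (1/3) ^ i)"
        by (intro suminf_le a geo bound[OF u])
      also have "\<dots> = (3/2) * ns_norm X u"
        by (subst suminf_mult) (auto simp: summable_geometric suminf_geometric)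
      finally show ?thesis .
    qed
    ultimately show ?thesis
      unfolding ns_dual_def by blast
  qed
  then have "(\<lambda>n. \<phi> (x n)) \<longlonglongrightarrow> 0"
    using x by (simp add: weakly_null_def)
  then have "Bseq (\<lambda>n. \<phi> (x n))"
    by (intro convergent_imp_Bseq convergentI)
  then obtain B where B: "\<And>n. \<bar>\<phi> (x n)\<bar> \<le> B"
    by (auto simp: Bseq_def)
  have "real k \<le> B" for k
  proof -
    let ?u = "x (\<nu> k)"
    let ?N = "ns_norm X ?u"
    have N0: "?N \<ge> 0"
      using \<psi>(3)[OF xc, of 0 "\<nu> k"] by linarith
    have "\<bar>\<Phi> (Suc k) ?u\<bar> \<ge> ?N / 3 ^ k"
      using N0 by (auto simp: \<Phi> s_def step_def \<psi>(2) abs_if split: if_splits)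
    moreover have "\<bar>\<phi> ?u - \<Phi> (Suc k) ?u\<bar> \<le> ?N / (2 * 3 ^ k)"
    proof -
      have e: "\<phi> ?u - \<Phi> (Suc k) ?u = (\<Sum>i. s (i + Suc k) * \<psi> (i + Suc k) ?u / 3 ^ (i + Suc k))"
        unfolding \<phi>_def sum using suminf_split_initial_segment[OF summ[OF xc[of "\<nu> k"]], of "Suc k"]
        by linarith
      have b: "\<bar>s (i + Suc k) * \<psi> (i + Suc k) ?u / 3 ^ (i + Suc k)\<bar> \<le> ?N / 3 ^ Suc k * (1/3) ^ i" for i
        using bound[OF xc[of "\<nu> k"], of "i + Suc k"] by (simp add: power_add power_one_over mult_ac)
      have g: "summable (\<lambda>i. ?N / 3 ^ Suc k * (1/3::real) ^ i)"
        by (intro summable_mult summable_geometric) auto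
      have a: "summable (\<lambda>i. \<bar>s (i + Suc k) * \<psi> (i + Suc k) ?u / 3 ^ (i + Suc k)\<bar>)"
        by (rule summable_comparison_test'[OF g, of 0]) (unfold real_norm_def abs_idempotent, rule b)
      have "\<bar>\<phi> ?u - \<Phi> (Suc k) ?u\<bar> \<le> (\<Sum>i. \<bar>s (i + Suc k) * \<psi> (i + Suc k) ?u / 3 ^ (i + Suc k)\<bar>)"
        unfolding e by (rule summable_rabs[OF a])
      also have "\<dots> \<le> (\<Sum>i. ?N / 3 ^ Suc k * (1/3) ^ i)"
        by (intro suminf_le a g b)
      also have "\<dots> = ?N / (2 * 3 ^ k)"
        by (subst suminf_mult) (auto simp: summable_geometric suminf_geometric)
      finally show ?thesis .
    qed
    moreover have "?N / 3 ^ k = 2 * (?N / (2 * 3 ^ k))"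
      by simp
    ultimately have "?N / (2 * 3 ^ k) \<le> \<bar>\<phi> ?u\<bar>"
      by linarith
    moreover have "real k \<le> ?N / (2 * 3 ^ k)"
      using \<nu>[of k] by (simp add: field_simps)
    ultimately show ?thesis
      using B[of "\<nu> k"] by linarith
  qed
  then show False
    by (metis not_le reals_Archimedean2)
qed

text \<open>The diagonal argument in topological form: a product of compact intervals is compact,
  and countability of the index type makes the product first countable, so compactness yields
  convergent subsequences.\<close>

lemma pointwise_bounded_subsequence:
  fixes u :: "nat \<Rightarrow> 'i::countable \<Rightarrow> real"
  assumes "\<And>n i. \<bar>u n i\<bar> \<le> c i"
  obtains s where "strict_mono s" "\<And>i. convergent (\<lambda>n. u (s n) i)"
proof -
  have "compactin (product_topology (\<lambda>i. euclidean) UNIV) (\<Pi>\<^sub>E i\<in>UNIV. {- c i..c i})"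
    unfolding compactin_PiE by simp
  then have "compact (\<Pi>\<^sub>E i\<in>UNIV. {- c i..c i})"
    by (simp add: euclidean_product_topology)
  then have "seq_compact (\<Pi>\<^sub>E i\<in>UNIV. {- c i..c i})"
    by (simp add: compact_imp_seq_compact)
  moreover have "u n \<in> (\<Pi>\<^sub>E i\<in>UNIV. {- c i..c i})" for n
    using assms by (auto simp: abs_le_iff minus_le_iff)
  ultimately obtain l s where s: "strict_mono s" "(u \<circ> s) \<longlonglongrightarrow> l"
    unfolding seq_compact_def by blast
  have "convergent (\<lambda>n. u (s n) i)" for i
  proof -
    have "(\<lambda>n. (u \<circ> s) n i) \<longlonglongrightarrow> l i"
      by (rule continuous_on_tendsto_compose[where f="\<lambda>x. x i" and s=UNIV, OF _ s(2)]) auto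
    then show ?thesis
      by (auto simp: convergent_def)
  qed
  with s(1) that show ?thesis
    by blast
qed

section \<open>Means of weakly null sequences in \<open>L\<^sub>1\<close>\<close>

lemma integrable_indicator_real_mult:
  fixes f :: "'a \<Rightarrow> real"
  assumes "integrable M f" "A \<in> sets M"
  shows "integrable M (\<lambda>x. indicator A x * f x)"
  using integrable_real_mult_indicator[OF assms(2,1)] by (simp add: mult.commute)

lemma integrable_truncation_tendsto:
  fixes f :: "'a \<Rightarrow> real"
  assumes f: "integrable M f"
  shows "(\<lambda>n. \<integral>x. indicator {x. real n < \<bar>f x\<bar>} x * \<bar>f x\<bar> \<partial>M) \<longlonglongrightarrow> 0"
proof -
  have [measurable]: "f \<in> borel_measurable M"
    using f by simp
  have "(\<lambda>n. \<integral>x. indicator {x. real n < \<bar>f x\<bar>} x * \<bar>f x\<bar> \<partial>M) \<longlonglongrightarrow> (\<integral>x. 0 \<partial>M)"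
  proof (rule integral_dominated_convergence[where w="\<lambda>x. \<bar>f x\<bar>"])
    show "AE x in M. (\<lambda>n. indicator {x. real n < \<bar>f x\<bar>} x * \<bar>f x\<bar>) \<longlonglongrightarrow> 0"
    proof (intro AE_I2 tendsto_eventually)
      fix x
      obtain N where "\<bar>f x\<bar> \<le> real N"
        using real_arch_simple by blast
      then show "\<forall>\<^sub>F n in sequentially. indicator {x. real n < \<bar>f x\<bar>} x * \<bar>f x\<bar> = 0"
        by (intro eventually_sequentiallyI[of N]) (auto simp: indicator_def)
    qed
  qed (use f in \<open>auto simp: indicator_def\<close>)
  then show ?thesis
    by simp
qed

lemma integrable_absolutely_continuous:
  fixes f :: "'a \<Rightarrow> real"
  assumes f: "integrable M f" and e: "0 < e"
  obtains d where "0 < d"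
    "\<And>A. A \<in> sets M \<Longrightarrow> emeasure M A < ennreal d \<Longrightarrow> (\<integral>x. indicator A x * \<bar>f x\<bar> \<partial>M) \<le> e"
proof -
  have [measurable]: "f \<in> borel_measurable M"
    using f by simp
  have "\<forall>\<^sub>F n in sequentially. (\<integral>x. indicator {x. real n < \<bar>f x\<bar>} x * \<bar>f x\<bar> \<partial>M) < e / 2"
    using e by (intro order_tendstoD(2)[OF integrable_truncation_tendsto[OF f]]) auto
  then obtain n where n: "(\<integral>x. indicator {x. real n < \<bar>f x\<bar>} x * \<bar>f x\<bar> \<partial>M) < e / 2"
    by (auto simp: eventually_sequentially)
  \<comment> \<open>On \<open>A\<close>, |f| is at most its part above the level n plus n. The
    summand 1 avoids a division by 0 when n = 0.\<close>
  define d where "d = e / (2 * (real n + 1))"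
  show ?thesis
  proof
    show "0 < d"
      using e by (simp add: d_def)
    fix A assume A: "A \<in> sets M" "emeasure M A < ennreal d"
    then have fin: "emeasure M A < \<infinity>"
      by (metis ennreal_less_top infinity_ennreal_def order_less_trans)
    have iA: "integrable M (\<lambda>x. real n * indicator A x)"
      using A(1) fin by simp
    have it: "integrable M (\<lambda>x. indicator {x. real n < \<bar>f x\<bar>} x * \<bar>f x\<bar>)"
      by (rule Bochner_Integration.integrable_bound[OF f]) (auto simp: indicator_def)
    have "(\<integral>x. indicator A x * \<bar>f x\<bar> \<partial>M) \<le>
        (\<integral>x. indicator {x. real n < \<bar>f x\<bar>} x * \<bar>f x\<bar> + real n * indicator A x \<partial>M)"
    proof (rule integral_mono)
      show "integrable M (\<lambda>x. indicator A x * \<bar>f x\<bar>)"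
        using f A by (intro integrable_indicator_real_mult) auto
    qed (use iA it in \<open>auto simp: indicator_def\<close>)
    also have "\<dots> = (\<integral>x. indicator {x. real n < \<bar>f x\<bar>} x * \<bar>f x\<bar> \<partial>M) + real n * measure M A"
      using iA it A(1) fin by (subst Bochner_Integration.integral_add) auto
    also have "real n * measure M A \<le> real n * d"
    proof (rule mult_left_mono)
      have "ennreal (measure M A) < ennreal d"
        using A(2) fin by (simp add: emeasure_eq_ennreal_measure)
      then show "measure M A \<le> d"
        by (auto simp: ennreal_less_iff)
    qed simp
    also have "real n * d \<le> e / 2"
      using e by (simp add: d_def divide_simps)
    finally show "(\<integral>x. indicator A x * \<bar>f x\<bar> \<partial>M) \<le> e"
      using n by simp
  qed
qed

text \<open>
  A gliding hump: if the conclusion fails, there are small sets \<open>B k\<close> carrying much of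
  \<open>f (r k)\<close>. Adding or removing \<open>B k\<close> at stage \<open>k\<close> keeps the integral of \<open>f (r k)\<close> over the current
  set away from \<open>0\<close>, and the later modifications are too small to spoil this.
\<close>

lemma integral_null_imp_equi_continuous:
  fixes f :: "nat \<Rightarrow> 'a \<Rightarrow> real"
  assumes int: "\<And>n. integrable M (f n)"
    and null: "\<And>A. A \<in> sets M \<Longrightarrow> (\<lambda>n. \<integral>x. indicator A x * f n x \<partial>M) \<longlonglongrightarrow> 0"
    and e: "0 < e"
  obtains d where "0 < d"
    "\<And>n A. A \<in> sets M \<Longrightarrow> emeasure M A < ennreal d \<Longrightarrow> (\<integral>x. indicator A x * \<bar>f n x\<bar> \<partial>M) \<le> e"
proof (rule ccontr)
  assume neg: "\<not> thesis"
  have [measurable]: "f n \<in> borel_measurable M" for n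
    using int[of n] by simp
  have fin: "\<exists>d>0. \<forall>n\<in>set xs. \<forall>A\<in>sets M. emeasure M A < ennreal d \<longrightarrow> (\<integral>x. indicator A x * \<bar>f n x\<bar> \<partial>M) \<le> c"
    if "0 < c" for c xs
  proof (induction xs)
    case Nil
    show ?case by (auto intro: exI[of _ 1])
  next
    case (Cons a xs)
    then obtain d where d: "d > 0" "\<forall>n\<in>set xs. \<forall>A\<in>sets M. emeasure M A < ennreal d \<longrightarrow> (\<integral>x. indicator A x * \<bar>f n x\<bar> \<partial>M) \<le> c"
      by blast
    obtain d' where d': "0 < d'"
      "\<And>A. A \<in> sets M \<Longrightarrow> emeasure M A < ennreal d' \<Longrightarrow> (\<integral>x. indicator A x * \<bar>f a x\<bar> \<partial>M) \<le> c"
      using integrable_absolutely_continuous[OF int[of a] \<open>0 < c\<close>] by blast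
    have *: "emeasure M A < ennreal d" "emeasure M A < ennreal d'" if "emeasure M A < ennreal (min d d')" for A
      using that d(1) d'(1) by (auto elim!: less_le_trans intro: ennreal_leI)
    show ?case
      using d d' * by (intro exI[of _ "min d d'"]) auto
  qed
  \<comment> \<open>The set chosen at stage j changes the integrals of the earlier functions by at
    most e / 2 ^ (j + 3). Summed over j > k this is at most e / 8, half of the e / 4 secured at
    stage k.\<close>
  have "\<exists>d>0. \<forall>n\<in>set xs. \<forall>A\<in>sets M. emeasure M A < ennreal d \<longrightarrow>
      (\<integral>x. indicator A x * \<bar>f n x\<bar> \<partial>M) \<le> e / 2 ^ (length xs + 3)" for xs
    using e by (intro fin) auto
  then obtain \<delta> where \<delta>: "\<And>xs. \<delta> xs > 0" "\<And>xs n A. n \<in> set xs \<Longrightarrow> A \<in> sets M \<Longrightarrow>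
      emeasure M A < ennreal (\<delta> xs) \<Longrightarrow> (\<integral>x. indicator A x * \<bar>f n x\<bar> \<partial>M) \<le> e / 2 ^ (length xs + 3)"
    by metis
  define Q where "Q xs n \<longleftrightarrow> (\<exists>B\<in>sets M. emeasure M B < ennreal (\<delta> xs) \<and>
      e / 2 \<le> \<bar>\<integral>x. indicator B x * f n x \<partial>M\<bar>)" for xs n
  have "\<exists>\<^sub>F n in sequentially. Q xs n" for xs
    unfolding frequently_sequentially
  proof
    fix N
    \<comment> \<open>Sets of measure below this \<open>d\<close> are harmless for the first N
      functions, so a violation on such a set must come from an index n \<ge> N.\<close>
    obtain d where d: "d > 0" "\<forall>n\<in>set [0..<N]. \<forall>A\<in>sets M. emeasure M A < ennreal d \<longrightarrow>
        (\<integral>x. indicator A x * \<bar>f n x\<bar> \<partial>M) \<le> e"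
      using fin[OF e, of "[0..<N]"] by blast
    have "\<exists>n A. A \<in> sets M \<and> emeasure M A < ennreal (min d (\<delta> xs)) \<and> e < (\<integral>x. indicator A x * \<bar>f n x\<bar> \<partial>M)"
    proof (rule ccontr)
      assume "\<not> ?thesis"
      then have "\<And>n A. A \<in> sets M \<Longrightarrow> emeasure M A < ennreal (min d (\<delta> xs)) \<Longrightarrow> (\<integral>x. indicator A x * \<bar>f n x\<bar> \<partial>M) \<le> e"
        by (meson not_le)
      moreover have "0 < min d (\<delta> xs)"
        using d(1) \<delta>(1)[of xs] by simp
      ultimately show False
        using neg that by blast
    qed
    then obtain n A where A: "A \<in> sets M" "emeasure M A < ennreal (min d (\<delta> xs))"
        "e < (\<integral>x. indicator A x * \<bar>f n x\<bar> \<partial>M)"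
      by blast
    have less: "emeasure M A < ennreal d" "emeasure M A < ennreal (\<delta> xs)"
      using A(2) d(1) \<delta>(1)[of xs] by (auto elim!: less_le_trans intro: ennreal_leI)
    have "N \<le> n"
    proof (rule ccontr)
      assume "\<not> N \<le> n"
      then have "n \<in> set [0..<N]" by simp
      then show False
        using d(2) A(1,3) less(1) by (meson not_le)
    qed
    \<comment> \<open>The integral of |f n| over \<open>A\<close> splits by the sign of
      \<open>f n\<close>; one of the two parts carries at least half of it without
      cancellation.\<close>
    define P where "P = A \<inter> {x\<in>space M. 0 \<le> f n x}"
    define P' where "P' = A \<inter> {x\<in>space M. f n x < 0}"
    have sets: "P \<in> sets M" "P' \<in> sets M"
      using A(1) by (auto simp: P_def P'_def)
    have "(\<integral>x. indicator A x * \<bar>f n x\<bar> \<partial>M) =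
        (\<integral>x. indicator P x * f n x - indicator P' x * f n x \<partial>M)"
      by (intro Bochner_Integration.integral_cong) (auto simp: P_def P'_def indicator_def)
    also have "\<dots> = (\<integral>x. indicator P x * f n x \<partial>M) - (\<integral>x. indicator P' x * f n x \<partial>M)"
      by (intro Bochner_Integration.integral_diff integrable_indicator_real_mult int sets)
    finally have "e / 2 \<le> \<bar>\<integral>x. indicator P x * f n x \<partial>M\<bar> \<or> e / 2 \<le> \<bar>\<integral>x. indicator P' x * f n x \<partial>M\<bar>"
      using A(3) by linarith
    moreover have "emeasure M P \<le> emeasure M A" "emeasure M P' \<le> emeasure M A"
      using A(1) by (auto intro!: emeasure_mono simp: P_def P'_def)
    ultimately have "Q xs n"
      unfolding Q_def using sets less(2) by (meson le_less_trans)
    with \<open>N \<le> n\<close> show "\<exists>n\<ge>N. Q xs n"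
      by blast
  qed
  from strict_mono_selection[of Q, OF this] obtain r where r: "strict_mono r"
      and Q: "\<And>k. Q (map r [0..<k]) (r k)"
    by blast
  from Q obtain B where B: "\<And>k. B k \<in> sets M" "\<And>k. emeasure M (B k) < ennreal (\<delta> (map r [0..<k]))"
      "\<And>k. e / 2 \<le> \<bar>\<integral>x. indicator (B k) x * f (r k) x \<partial>M\<bar>"
    unfolding Q_def by metis
  have small: "(\<integral>x. indicator (B j) x * \<bar>f (r k) x\<bar> \<partial>M) \<le> e / 2 ^ (j + 3)" if "k < j" for j k
    using \<delta>(2)[OF _ B(1,2), of "r k" j] that by simp
  define C where "C = rec_nat {} (\<lambda>k C. if e / 4 \<le> \<bar>\<integral>x. indicator (C \<union> B k) x * f (r k) x \<partial>M\<bar> then C \<union> B k else C - B k)"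
  have CS: "C (Suc k) = (if e / 4 \<le> \<bar>\<integral>x. indicator (C k \<union> B k) x * f (r k) x \<partial>M\<bar> then C k \<union> B k else C k - B k)" for k
    by (simp add: C_def)
  have Csets: "C k \<in> sets M" for k
  proof (induction k)
    case 0
    show ?case by (simp add: C_def)
  qed (use B(1) in \<open>auto simp: CS\<close>)
  \<comment> \<open>The integrals over \<open>C k \<union> B k\<close> and \<open>C k - B k\<close>
    differ by the integral over \<open>B k\<close>, which is at least e / 2 in absolute value. They
    cannot both be below e / 4.\<close>
  have big: "e / 4 \<le> \<bar>\<integral>x. indicator (C (Suc k)) x * f (r k) x \<partial>M\<bar>" for k
  proof -
    have "(\<integral>x. indicator (B k) x * f (r k) x \<partial>M) =
        (\<integral>x. indicator (C k \<union> B k) x * f (r k) x - indicator (C k - B k) x * f (r k) x \<partial>M)"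
      by (intro Bochner_Integration.integral_cong) (auto simp: indicator_def)
    also have "\<dots> = (\<integral>x. indicator (C k \<union> B k) x * f (r k) x \<partial>M) - (\<integral>x. indicator (C k - B k) x * f (r k) x \<partial>M)"
      using Csets B(1) by (intro Bochner_Integration.integral_diff integrable_indicator_real_mult int) auto
    finally have eq: "(\<integral>x. indicator (B k) x * f (r k) x \<partial>M) =
        (\<integral>x. indicator (C k \<union> B k) x * f (r k) x \<partial>M) - (\<integral>x. indicator (C k - B k) x * f (r k) x \<partial>M)" .
    show ?thesis
    proof (cases "e / 4 \<le> \<bar>\<integral>x. indicator (C k \<union> B k) x * f (r k) x \<partial>M\<bar>")
      case False
      then have "e / 4 \<le> \<bar>\<integral>x. indicator (C k - B k) x * f (r k) x \<partial>M\<bar>"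
        using B(3)[of k] eq by linarith
      with False show ?thesis
        by (simp add: CS)
    qed (simp add: CS)
  qed
  \<comment> \<open>The lower limit of the sets \<open>C k\<close>. Membership of a point is frozen
    once no later \<open>B i\<close> contains it, so \<open>D\<close> and \<open>C (Suc k)\<close>
    differ only inside the union of the later \<open>B i\<close>.\<close>
  define D where "D = (\<Union>k. \<Inter>j\<in>{k..}. C j)"
  have Dsets: "D \<in> sets M"
    unfolding D_def using Csets by auto
  have stable: "x \<in> C j \<longleftrightarrow> x \<in> C k" if "k \<le> j" "\<And>i. k \<le> i \<Longrightarrow> x \<notin> B i" for x j k
    using that(1) by (induction rule: dec_induct) (use that(2) in \<open>auto simp: CS\<close>)
  have DC: "x \<in> D \<longleftrightarrow> x \<in> C k" if "\<And>i. k \<le> i \<Longrightarrow> x \<notin> B i" for x k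
  proof
    assume "x \<in> C k"
    then show "x \<in> D"
      using stable[OF _ that] by (auto simp: D_def)
  next
    assume "x \<in> D"
    then obtain l where "\<And>j. l \<le> j \<Longrightarrow> x \<in> C j"
      by (auto simp: D_def)
    then have "x \<in> C (max k l)"
      by simp
    then show "x \<in> C k"
      using stable[of k "max k l" x] that by simp
  qed
  have lower: "e / 8 \<le> \<bar>\<integral>x. indicator D x * f (r k) x \<partial>M\<bar>" for k
  proof -
    define U where "U = (\<Union>j. B (j + Suc k))"
    have Usets: "U \<in> sets M"
      using B(1) by (auto simp: U_def)
    have "ennreal (\<integral>x. indicator U x * \<bar>f (r k) x\<bar> \<partial>M) = (\<integral>\<^sup>+x. ennreal (indicator U x * \<bar>f (r k) x\<bar>) \<partial>M)"
      using int Usets by (intro nn_integral_eq_integral[symmetric] integrable_indicator_real_mult) auto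
    also have "\<dots> \<le> (\<integral>\<^sup>+x. (\<Sum>j. ennreal (indicator (B (j + Suc k)) x * \<bar>f (r k) x\<bar>)) \<partial>M)"
    proof (intro nn_integral_mono)
      fix x
      show "ennreal (indicator U x * \<bar>f (r k) x\<bar>) \<le> (\<Sum>j. ennreal (indicator (B (j + Suc k)) x * \<bar>f (r k) x\<bar>))"
      proof (cases "x \<in> U")
        case True
        then obtain j where j: "x \<in> B (j + Suc k)"
          by (auto simp: U_def)
        have "ennreal (indicator U x * \<bar>f (r k) x\<bar>) = (\<Sum>i\<in>{j}. ennreal (indicator (B (i + Suc k)) x * \<bar>f (r k) x\<bar>))"
          using True j by simp
        also have "\<dots> \<le> (\<Sum>i. ennreal (indicator (B (i + Suc k)) x * \<bar>f (r k) x\<bar>))"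
          by (intro sum_le_suminf) auto
        finally show ?thesis .
      qed simp
    qed
    also have "\<dots> = (\<Sum>j. \<integral>\<^sup>+x. ennreal (indicator (B (j + Suc k)) x * \<bar>f (r k) x\<bar>) \<partial>M)"
      using B(1) by (intro nn_integral_suminf) (auto intro!: borel_measurable_times borel_measurable_indicator)
    also have "\<dots> = (\<Sum>j. ennreal (\<integral>x. indicator (B (j + Suc k)) x * \<bar>f (r k) x\<bar> \<partial>M))"
      using int B(1) by (intro suminf_cong nn_integral_eq_integral integrable_indicator_real_mult) auto
    also have "\<dots> \<le> (\<Sum>j. ennreal (e / 16 * (1/2) ^ j))"
    proof (intro suminf_le ennreal_leI)
      fix j
      have "(\<integral>x. indicator (B (j + Suc k)) x * \<bar>f (r k) x\<bar> \<partial>M) \<le> e / 2 ^ (j + Suc k + 3)"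
        by (intro small) simp
      also have "\<dots> \<le> e / 16 * (1/2) ^ j"
        using e by (simp add: power_add power_one_over divide_simps)
      finally show "(\<integral>x. indicator (B (j + Suc k)) x * \<bar>f (r k) x\<bar> \<partial>M) \<le> e / 16 * (1/2) ^ j" .
    qed auto
    also have "\<dots> = ennreal (\<Sum>j. e / 16 * (1/2) ^ j)"
      using e by (intro suminf_ennreal2 summable_mult summable_geometric) auto
    also have "(\<Sum>j. e / 16 * (1/2) ^ j) = e / 8"
      by (subst suminf_mult) (auto simp: summable_geometric suminf_geometric)
    finally have tail: "(\<integral>x. indicator U x * \<bar>f (r k) x\<bar> \<partial>M) \<le> e / 8"
      using e by simp
    have "\<bar>(\<integral>x. indicator D x * f (r k) x \<partial>M) - (\<integral>x. indicator (C (Suc k)) x * f (r k) x \<partial>M)\<bar> =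
        \<bar>\<integral>x. indicator D x * f (r k) x - indicator (C (Suc k)) x * f (r k) x \<partial>M\<bar>"
      using Csets Dsets
      by (subst Bochner_Integration.integral_diff) (auto intro!: integrable_indicator_real_mult int)
    also have "\<dots> \<le> (\<integral>x. \<bar>indicator D x * f (r k) x - indicator (C (Suc k)) x * f (r k) x\<bar> \<partial>M)"
      by (rule integral_abs_bound)
    also have "\<dots> \<le> (\<integral>x. indicator U x * \<bar>f (r k) x\<bar> \<partial>M)"
    proof (rule integral_mono)
      show "integrable M (\<lambda>x. \<bar>indicator D x * f (r k) x - indicator (C (Suc k)) x * f (r k) x\<bar>)"
        using Csets Dsets by (intro integrable_abs Bochner_Integration.integrable_diff integrable_indicator_real_mult int)
      show "integrable M (\<lambda>x. indicator U x * \<bar>f (r k) x\<bar>)"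
        using Usets by (intro integrable_abs integrable_indicator_real_mult int)
      fix x
      show "\<bar>indicator D x * f (r k) x - indicator (C (Suc k)) x * f (r k) x\<bar> \<le> indicator U x * \<bar>f (r k) x\<bar>"
      proof (cases "x \<in> U")
        case False
        have "x \<notin> B i" if "Suc k \<le> i" for i
          using False le_Suc_ex[OF that] by (auto simp: U_def add.commute)
        from DC[OF this] show ?thesis
          by (simp add: indicator_def)
      qed (simp add: indicator_def)
    qed
    finally show ?thesis
      using tail big[of k] by linarith
  qed
  have "(\<lambda>k. \<integral>x. indicator D x * f (r k) x \<partial>M) \<longlonglongrightarrow> 0"
    using LIMSEQ_subseq_LIMSEQ[OF null[OF Dsets] r] by (simp add: o_def)
  then have "\<forall>\<^sub>F k in sequentially. dist (\<integral>x. indicator D x * f (r k) x \<partial>M) 0 < e / 8"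
    using e by (intro tendstoD) auto
  then show False
    using lower by (auto simp: eventually_sequentially not_less[symmetric])
qed

text \<open>By Markov's inequality the set where |f n| exceeds L has measure at most B / L,
  uniformly in n. With L = (B + 1) / d this is strictly below d, and L is positive even if B =
  0.\<close>

lemma equi_continuous_imp_uniformly_integrable:
  fixes f :: "nat \<Rightarrow> 'a \<Rightarrow> real"
  assumes int: "\<And>n. integrable M (f n)"
    and B: "\<And>n. (\<integral>x. \<bar>f n x\<bar> \<partial>M) \<le> B"
    and d: "0 < d" "\<And>n A. A \<in> sets M \<Longrightarrow> emeasure M A < ennreal d \<Longrightarrow>
      (\<integral>x. indicator A x * \<bar>f n x\<bar> \<partial>M) \<le> e"
  shows "\<exists>L\<ge>0. \<forall>n. (\<integral>x. indicator {x. L < \<bar>f n x\<bar>} x * \<bar>f n x\<bar> \<partial>M) \<le> e"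
proof -
  have [measurable]: "f n \<in> borel_measurable M" for n
    using int[of n] by simp
  have "0 \<le> (\<integral>x. \<bar>f 0 x\<bar> \<partial>M)"
    by (rule Bochner_Integration.integral_nonneg) simp
  then have B0: "0 \<le> B"
    using B[of 0] by linarith
  define L where "L = (B + 1) / d"
  have L: "0 < L"
    using B0 d by (simp add: L_def)
  have "(\<integral>x. indicator {x. L < \<bar>f n x\<bar>} x * \<bar>f n x\<bar> \<partial>M) \<le> e" for n
  proof -
    define A where "A = {x\<in>space M. L < \<bar>f n x\<bar>}"
    have A: "A \<in> sets M"
      unfolding A_def by measurable
    have "emeasure M A \<le> ennreal (1 / L) * (\<integral>\<^sup>+x\<in>space M. ennreal \<bar>f n x\<bar> \<partial>M)"
    proof -
      have "emeasure M A \<le> emeasure M {x\<in>space M. 1 \<le> ennreal (1 / L) * ennreal \<bar>f n x\<bar>}"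
      proof (intro emeasure_mono)
        show "A \<subseteq> {x\<in>space M. 1 \<le> ennreal (1 / L) * ennreal \<bar>f n x\<bar>}"
          using L by (auto simp: A_def field_simps simp flip: ennreal_mult)
      qed measurable
      also have "\<dots> \<le> ennreal (1 / L) * (\<integral>\<^sup>+x\<in>space M. ennreal \<bar>f n x\<bar> \<partial>M)"
        using nn_integral_Markov_inequality[of "\<lambda>x. ennreal \<bar>f n x\<bar>" "space M" M "ennreal (1 / L)"]
        by (simp cong: conj_cong)
      finally show ?thesis .
    qed
    also have "(\<integral>\<^sup>+x\<in>space M. ennreal \<bar>f n x\<bar> \<partial>M) = ennreal (\<integral>x. \<bar>f n x\<bar> \<partial>M)"
      using int[of n] by (subst nn_integral_eq_integral[symmetric]) (auto intro!: nn_integral_cong)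
    also have "ennreal (1 / L) * \<dots> = ennreal ((\<integral>x. \<bar>f n x\<bar> \<partial>M) / L)"
      using L by (simp flip: ennreal_mult add: Bochner_Integration.integral_nonneg)
    also have "\<dots> < ennreal d"
    proof (rule ennreal_lessI)
      have "(\<integral>x. \<bar>f n x\<bar> \<partial>M) < L * d"
        using B[of n] d by (simp add: L_def)
      then show "(\<integral>x. \<bar>f n x\<bar> \<partial>M) / L < d"
        using L by (simp add: field_simps)
    qed (use d in simp)
    finally have "(\<integral>x. indicator A x * \<bar>f n x\<bar> \<partial>M) \<le> e"
      by (intro d A)
    also have "(\<integral>x. indicator A x * \<bar>f n x\<bar> \<partial>M) = (\<integral>x. indicator {x. L < \<bar>f n x\<bar>} x * \<bar>f n x\<bar> \<partial>M)"
      by (intro Bochner_Integration.integral_cong) (auto simp: A_def indicator_def)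
    finally show ?thesis .
  qed
  with L show ?thesis
    by (intro exI[of _ L]) auto
qed

section \<open>Huber functions and means in \<open>L\<^sub>1\<close>\<close>

definition clamp_real :: "real \<Rightarrow> real \<Rightarrow> real" where
  "clamp_real K t = max (- K) (min K t)"

text \<open>
  The infimal convolution of \<open>t\<^sup>2 / 2\<close> and \<open>K \<bar>t\<bar>\<close>. Its derivative \<open>clamp_real K\<close> is bounded, hence a
  legitimate test function against sequences that are weakly null in \<open>L\<^sub>1\<close>.
\<close>

definition huber :: "real \<Rightarrow> real \<Rightarrow> real" where
  "huber K t = (clamp_real K t)\<^sup>2 / 2 + K * \<bar>t - clamp_real K t\<bar>"

lemma abs_clamp_real_le: "0 \<le> K \<Longrightarrow> \<bar>clamp_real K t\<bar> \<le> K"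
  by (auto simp: clamp_real_def)

lemma borel_measurable_clamp_real [measurable]: "clamp_real K \<in> borel_measurable borel"
  unfolding clamp_real_def[abs_def] by measurable

lemma borel_measurable_huber [measurable]: "huber K \<in> borel_measurable borel"
  unfolding huber_def[abs_def] by measurable

text \<open>The definition evaluates y^2 / 2 + K |t - y| at its minimiser, the clamped point; here
  any trial point y is compared with it. In each of the three regions the claim is the nonnegativity
  of a square. The two growth estimates below are choices of y.\<close>

lemma huber_le:
  assumes "0 \<le> K"
  shows "huber K t \<le> y\<^sup>2 / 2 + K * \<bar>t - y\<bar>"
proof -
  have sq: "2 * K * y - K\<^sup>2 \<le> y\<^sup>2" "- (2 * K * y) - K\<^sup>2 \<le> y\<^sup>2" "2 * t * y - t\<^sup>2 \<le> y\<^sup>2"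
    using zero_le_power2[of "y - K"] zero_le_power2[of "y + K"] zero_le_power2[of "y - t"]
    by (simp_all add: power2_eq_square algebra_simps)
  consider "t < - K" | "K < t" | "\<bar>t\<bar> \<le> K"
    by linarith
  then show ?thesis
  proof cases
    case 1
    then have "K * (y - t) \<le> K * \<bar>t - y\<bar>"
      using assms by (intro mult_left_mono) auto
    then show ?thesis
      using 1 assms sq(2) by (simp add: huber_def clamp_real_def algebra_simps power2_eq_square)
  next
    case 2
    then have "K * (t - y) \<le> K * \<bar>t - y\<bar>"
      using assms by (intro mult_left_mono) auto
    then show ?thesis
      using 2 assms sq(1) by (simp add: huber_def clamp_real_def algebra_simps power2_eq_square)
  next
    case 3
    have "\<bar>t\<bar> * \<bar>t - y\<bar> \<le> K * \<bar>t - y\<bar>"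
      using 3 by (intro mult_right_mono) auto
    then have "t * (t - y) \<le> K * \<bar>t - y\<bar>"
      by (metis abs_ge_self abs_mult order_trans)
    then show ?thesis
      using 3 assms sq(3) by (simp add: huber_def clamp_real_def algebra_simps power2_eq_square)
  qed
qed

lemma huber_nonneg: "0 \<le> K \<Longrightarrow> 0 \<le> huber K t"
  by (simp add: huber_def)

lemma huber_0 [simp]: "0 \<le> K \<Longrightarrow> huber K 0 = 0"
  by (simp add: huber_def clamp_real_def)

lemma huber_add_le_quadratic:
  assumes "0 \<le> K"
  shows "huber K (s + t) \<le> huber K s + clamp_real K s * t + t\<^sup>2 / 2"
  using huber_le[OF assms, of "s + t" "clamp_real K s + t"]
  by (simp add: huber_def power2_sum field_simps)

lemma huber_add_le_linear:
  assumes "0 \<le> K"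
  shows "huber K (s + t) \<le> huber K s + K * \<bar>t\<bar>"
proof -
  have "K * \<bar>s + t - clamp_real K s\<bar> \<le> K * (\<bar>s - clamp_real K s\<bar> + \<bar>t\<bar>)"
    using assms by (intro mult_left_mono) auto
  then show ?thesis
    using huber_le[OF assms, of "s + t" "clamp_real K s"] by (simp add: huber_def algebra_simps)
qed

text \<open>Increments up to L are treated by the quadratic estimate, with t^2 \<le> L |t|. Larger
  ones use the linear estimate K |t|; inserting the first-order term there costs another K |t|,
  whence the factor 2.\<close>

lemma huber_add_le:
  assumes K: "0 \<le> K" and L: "0 \<le> L"
  shows "huber K (s + t) \<le> huber K s + clamp_real K s * t + L * \<bar>t\<bar> + 2 * K * (indicator {t. L < \<bar>t\<bar>} t * \<bar>t\<bar>)"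
proof (cases "L < \<bar>t\<bar>")
  case True
  have "\<bar>clamp_real K s * t\<bar> \<le> K * \<bar>t\<bar>"
    unfolding abs_mult by (intro mult_right_mono abs_clamp_real_le K) simp
  moreover have "0 \<le> L * \<bar>t\<bar>"
    using L by simp
  ultimately show ?thesis
    using True huber_add_le_linear[OF K, of s t] by (simp add: algebra_simps)
next
  case False
  have "t\<^sup>2 / 2 \<le> \<bar>t\<bar> * \<bar>t\<bar>"
    by (simp add: power2_eq_square flip: abs_mult)
  also have "\<dots> \<le> L * \<bar>t\<bar>"
    using False by (intro mult_right_mono) auto
  finally show ?thesis
    using False huber_add_le_quadratic[OF K, of s t] by simp
qed

lemma abs_le_huber:
  assumes "0 < K"
  shows "\<bar>t\<bar> \<le> huber K t / K + K / 2"
proof -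
  let ?c = "clamp_real K t"
  have "K * \<bar>?c\<bar> \<le> ?c\<^sup>2 / 2 + K\<^sup>2 / 2"
    using zero_le_power2[of "\<bar>?c\<bar> - K"] by (simp add: power2_diff algebra_simps)
  moreover have "K * \<bar>t\<bar> \<le> K * (\<bar>?c\<bar> + \<bar>t - ?c\<bar>)"
    using assms by (intro mult_left_mono) auto
  ultimately have "K * \<bar>t\<bar> \<le> huber K t + K\<^sup>2 / 2"
    by (simp add: huber_def algebra_simps)
  then show ?thesis
    using assms by (simp add: field_simps power2_eq_square)
qed

text \<open>
  Let \<open>S\<close> denote the partial sums. The almost orthogonality hypothesis makes \<open>\<integral>huber K S\<close> grow by
  at most \<open>1 + L B + 2 K \<eta>\<close> per step, with \<open>\<eta>\<close> the mass of the terms above the level \<open>L\<close>.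
  Since \<open>\<bar>t\<bar> \<le> huber K t / K + K / 2\<close>, the mean is at most \<open>(1 + L B) / K + 2 \<eta>\<close> up to \<open>O(1 / m)\<close>.
\<close>

lemma L1_means_tendsto_0:
  fixes f :: "nat \<Rightarrow> 'a \<Rightarrow> real"
  assumes int: "\<And>n. integrable M (f n)"
    and E: "E \<in> sets M" "emeasure M E < \<infinity>" "\<And>n x. x \<in> space M \<Longrightarrow> x \<notin> E \<Longrightarrow> f n x = 0"
    and B: "\<And>n. (\<integral>x. \<bar>f n x\<bar> \<partial>M) \<le> B"
    and ui: "\<And>e. 0 < e \<Longrightarrow> \<exists>L\<ge>0. \<forall>n. (\<integral>x. indicator {x. L < \<bar>f n x\<bar>} x * \<bar>f n x\<bar> \<partial>M) \<le> e"
    and almost_orthogonal: "\<And>k K. start \<le> k \<Longrightarrow> K \<le> k \<Longrightarrow>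
      \<bar>\<integral>x. clamp_real (real K) (\<Sum>i<k. f (r i) x) * f (r k) x \<partial>M\<bar> \<le> 1"
  shows "(\<lambda>m. (\<integral>x. \<bar>\<Sum>k<m. f (r k) x\<bar> \<partial>M) / real m) \<longlonglongrightarrow> 0"
proof (rule tendstoI)
  fix \<epsilon> :: real assume \<epsilon>: "0 < \<epsilon>"
  define S where "S m x = (\<Sum>k<m. f (r k) x)" for m x
  have [measurable]: "f n \<in> borel_measurable M" for n
    using int[of n] by simp
  have [measurable]: "S m \<in> borel_measurable M" for m
    unfolding S_def[abs_def] by measurable
  have Sint: "integrable M (S m)" for m
    unfolding S_def[abs_def] by (intro Bochner_Integration.integrable_sum int)
  \<comment> \<open>Budget: the mass above L contributes 2 * (\<epsilon> / 8), the term (1 + L B) /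
    K at most \<epsilon> / 4, and the constant \<open>c\<close> divided by m less than \<epsilon> /
    4.\<close>
  obtain L where L: "L \<ge> 0" "\<And>n. (\<integral>x. indicator {x. L < \<bar>f n x\<bar>} x * \<bar>f n x\<bar> \<partial>M) \<le> \<epsilon> / 8"
    using ui[of "\<epsilon> / 8"] \<epsilon> by auto
  obtain K0 :: nat where "4 * (1 + L * B) / \<epsilon> < real K0"
    using reals_Archimedean2 by blast
  define K where "K = Suc K0"
  have K: "0 < real K" "(1 + L * B) / real K \<le> \<epsilon> / 4"
  proof -
    have "4 * (1 + L * B) / \<epsilon> \<le> real K"
      using \<open>_ < real K0\<close> by (simp add: K_def)
    then show "(1 + L * B) / real K \<le> \<epsilon> / 4"
      using \<epsilon> by (simp add: field_simps K_def)
  qed (simp add: K_def)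
  have Hint: "integrable M (\<lambda>x. huber (real K) (S m x))" for m
  proof (rule Bochner_Integration.integrable_bound)
    show "integrable M (\<lambda>x. real K * \<bar>S m x\<bar>)"
      using Sint by simp
    show "AE x in M. norm (huber (real K) (S m x)) \<le> norm (real K * \<bar>S m x\<bar>)"
      using huber_add_le_linear[of "real K" 0] by (simp add: huber_nonneg)
  qed measurable
  define D where "D = 1 + L * B + 2 * real K * (\<epsilon> / 8)"
  define a where "a m = (\<integral>x. huber (real K) (S m x) \<partial>M)" for m
  \<comment> \<open>Almost orthogonality at level K is available only from this stage on. Everything
    before it enters through the single constant \<open>a N\<close>.\<close>
  define N where "N = max K start"
  have step: "a (Suc m) \<le> a m + D" if m: "N \<le> m" for m
  proof -
    have i1: "integrable M (\<lambda>x. clamp_real (real K) (S m x) * f (r m) x)"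
    proof (rule Bochner_Integration.integrable_bound)
      show "integrable M (\<lambda>x. real K * \<bar>f (r m) x\<bar>)"
        using int by simp
      show "AE x in M. norm (clamp_real (real K) (S m x) * f (r m) x) \<le> norm (real K * \<bar>f (r m) x\<bar>)"
        using abs_clamp_real_le[of "real K"] by (auto simp: abs_mult intro!: mult_right_mono)
    qed measurable
    have i2: "integrable M (\<lambda>x. indicator {x. L < \<bar>f (r m) x\<bar>} x * \<bar>f (r m) x\<bar>)"
      by (rule Bochner_Integration.integrable_bound[OF int[of "r m"]]) (auto simp: indicator_def)
    have "a (Suc m) \<le> (\<integral>x. huber (real K) (S m x) + clamp_real (real K) (S m x) * f (r m) x +
        L * \<bar>f (r m) x\<bar> + 2 * real K * (indicator {x. L < \<bar>f (r m) x\<bar>} x * \<bar>f (r m) x\<bar>) \<partial>M)"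
      unfolding a_def
    proof (intro integral_mono Hint)
      show "integrable M (\<lambda>x. huber (real K) (S m x) + clamp_real (real K) (S m x) * f (r m) x +
        L * \<bar>f (r m) x\<bar> + 2 * real K * (indicator {x. L < \<bar>f (r m) x\<bar>} x * \<bar>f (r m) x\<bar>))"
        using i1 i2 int Hint by (intro Bochner_Integration.integrable_add integrable_mult_right integrable_abs)
    next
      fix x
      show "huber (real K) (S (Suc m) x) \<le> huber (real K) (S m x) + clamp_real (real K) (S m x) * f (r m) x +
        L * \<bar>f (r m) x\<bar> + 2 * real K * (indicator {x. L < \<bar>f (r m) x\<bar>} x * \<bar>f (r m) x\<bar>)"
        using huber_add_le[of "real K" L "S m x" "f (r m) x"] L(1) by (simp add: S_def indicator_def)
    qed
    also have "\<dots> = a m + (\<integral>x. clamp_real (real K) (S m x) * f (r m) x \<partial>M) +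
        L * (\<integral>x. \<bar>f (r m) x\<bar> \<partial>M) + 2 * real K * (\<integral>x. indicator {x. L < \<bar>f (r m) x\<bar>} x * \<bar>f (r m) x\<bar> \<partial>M)"
      using i1 i2 int Hint unfolding a_def by simp
    also have "\<dots> \<le> a m + 1 + L * B + 2 * real K * (\<epsilon> / 8)"
    proof (intro add_mono mult_left_mono B L order_refl)
      show "(\<integral>x. clamp_real (real K) (S m x) * f (r m) x \<partial>M) \<le> 1"
        using almost_orthogonal[of m K] m by (simp add: S_def N_def abs_le_iff)
    qed (use L(1) in auto)
    finally show ?thesis
      by (simp add: D_def)
  qed
  have "0 \<le> (\<integral>x. \<bar>f 0 x\<bar> \<partial>M)"
    by (rule Bochner_Integration.integral_nonneg) simp
  then have B0: "0 \<le> B"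
    using B[of 0] by linarith
  have D0: "0 \<le> D"
    using L(1) \<epsilon> B0 by (simp add: D_def)
  have a_le: "a m \<le> a N + real m * D" if "N \<le> m" for m
    using that
  proof (induction rule: dec_induct)
    case base
    show ?case using D0 by simp
  next
    case (step m)
    then show ?case
      using \<open>\<And>m. N \<le> m \<Longrightarrow> a (Suc m) \<le> a m + D\<close>[of m] by (simp add: algebra_simps)
  qed
  \<comment> \<open>The additive K / 2 in the comparison of |t| with the Huber function is charged
    only on \<open>E\<close>, since all terms vanish outside. Finite measure of \<open>E\<close>
    turns it into a constant, which division by m removes.\<close>
  have bound: "(\<integral>x. \<bar>S m x\<bar> \<partial>M) \<le> a m / real K + real K / 2 * measure M E" for m
  proof -
    have iE: "integrable M (\<lambda>x. real K / 2 * indicator E x)"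
      using E(1,2) by (intro integrable_mult_right integrable_real_indicator)
    have "(\<integral>x. \<bar>S m x\<bar> \<partial>M) \<le> (\<integral>x. huber (real K) (S m x) / real K + real K / 2 * indicator E x \<partial>M)"
    proof (rule integral_mono)
      fix x assume x: "x \<in> space M"
      show "\<bar>S m x\<bar> \<le> huber (real K) (S m x) / real K + real K / 2 * indicator E x"
      proof (cases "x \<in> E")
        case True
        then show ?thesis
          using abs_le_huber[OF K(1), of "S m x"] by simp
      next
        case False
        then show ?thesis
          using E(3)[OF x] by (simp add: S_def)
      qed
    qed (use Sint Hint iE in auto)
    also have "\<dots> = a m / real K + real K / 2 * measure M E"
      using Hint iE E by (subst Bochner_Integration.integral_add) (auto simp: a_def)
    finally show ?thesis .
  qed
  define c where "c = a N / real K + real K / 2 * measure M E"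
  have "(\<lambda>m. c / real m) \<longlonglongrightarrow> 0"
    by (rule lim_const_over_n)
  then have "\<forall>\<^sub>F m in sequentially. c / real m < \<epsilon> / 4"
    using \<epsilon> by (intro order_tendstoD(2)) auto
  moreover have "\<forall>\<^sub>F m in sequentially. max 1 N \<le> m"
    by (rule eventually_ge_at_top)
  ultimately show "\<forall>\<^sub>F m in sequentially. dist ((\<integral>x. \<bar>\<Sum>k<m. f (r k) x\<bar> \<partial>M) / real m) 0 < \<epsilon>"
  proof eventually_elim
    case (elim m)
    have m: "0 < real m" "N \<le> m"
      using elim(2) by auto
    have "(\<integral>x. \<bar>S m x\<bar> \<partial>M) \<le> c + real m * D / real K"
      using bound[of m] divide_right_mono[OF a_le[OF m(2)], of "real K"] K(1)
      by (simp add: c_def add_divide_distrib)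
    then have "(\<integral>x. \<bar>S m x\<bar> \<partial>M) / real m \<le> (c + real m * D / real K) / real m"
      using m by (intro divide_right_mono) auto
    also have "\<dots> = c / real m + D / real K"
      using m K by (simp add: field_simps)
    also have "D / real K = (1 + L * B) / real K + \<epsilon> / 4"
      using K by (simp add: D_def add_divide_distrib)
    finally have "(\<integral>x. \<bar>S m x\<bar> \<partial>M) / real m < \<epsilon>"
      using elim(1) K(2) \<epsilon> by linarith
    moreover have "0 \<le> (\<integral>x. \<bar>S m x\<bar> \<partial>M) / real m"
      by simp
    ultimately show ?case
      by (simp add: S_def)
  qed
qed

section \<open>Sums of almost disjoint functions in \<open>L\<^sub>p\<close>\<close>

text \<open>For d \<le> s the bracket is the exact increment; for d > s one has s + d \<le> 2 d.
  Capping d by s bounds the bracket by a multiple of s^p that does not depend on d.\<close>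

lemma powr_add_le_min:
  fixes s d p :: real
  assumes "0 \<le> s" "0 \<le> d" "0 \<le> p"
  shows "(s + d) powr p \<le> s powr p + 2 powr p * d powr p + ((s + min s d) powr p - s powr p)"
proof (cases "d \<le> s")
  case True
  then show ?thesis
    by (simp add: min_absorb2)
next
  case False
  have "(s + d) powr p \<le> (2 * d) powr p"
    using False assms by (intro powr_mono2) auto
  also have "\<dots> = 2 powr p * d powr p"
    using assms by (simp add: powr_mult)
  finally show ?thesis
    using powr_ge_zero[of "s + min s d" p] by linarith
qed

lemma powr_add_le:
  fixes a b p :: real
  assumes "0 \<le> a" "0 \<le> b" "0 \<le> p"
  shows "(a + b) powr p \<le> 2 powr p * (a powr p + b powr p)"
proof -
  have "(a + b) powr p \<le> (2 * max a b) powr p"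
    using assms by (intro powr_mono2) auto
  also have "\<dots> = 2 powr p * max a b powr p"
    using assms by (simp add: powr_mult)
  also have "\<dots> \<le> 2 powr p * (a powr p + b powr p)"
    by (intro mult_left_mono) (auto simp: max_def)
  finally show ?thesis .
qed

lemma integrable_powr_add:
  fixes f g :: "'a \<Rightarrow> real"
  assumes [measurable]: "f \<in> borel_measurable M" "g \<in> borel_measurable M"
    and "\<And>x. 0 \<le> f x" "\<And>x. 0 \<le> g x" "0 \<le> p"
    and "integrable M (\<lambda>x. f x powr p)" "integrable M (\<lambda>x. g x powr p)"
  shows "integrable M (\<lambda>x. (f x + g x) powr p)"
proof (rule Bochner_Integration.integrable_bound)
  show "integrable M (\<lambda>x. 2 powr p * (f x powr p + g x powr p))"
    using assms by simp
  show "AE x in M. norm ((f x + g x) powr p) \<le> norm (2 powr p * (f x powr p + g x powr p))"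
    using assms(3-5) by (auto simp: powr_add_le)
qed measurable

lemma integrable_powr_sum:
  fixes D :: "'i \<Rightarrow> 'a \<Rightarrow> real" and m :: nat
  assumes "\<And>i. D i \<in> borel_measurable M" "\<And>i x. 0 \<le> D i x" "0 < p"
    and "\<And>i. integrable M (\<lambda>x. D i x powr p)"
  shows "integrable M (\<lambda>x. (\<Sum>i<m. D (g i) x) powr p)"
proof (induction m)
  case (Suc m)
  have [measurable]: "\<And>i. D i \<in> borel_measurable M"
    by fact
  have "integrable M (\<lambda>x. ((\<Sum>i<m. D (g i) x) + D (g m) x) powr p)"
    using assms by (intro integrable_powr_add Suc.IH) (auto intro: sum_nonneg)
  then show ?case
    by simp
qed simp

text \<open>The cap by \<open>s\<close> supplies the majorant 2^p s^p for dominated convergence,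
  although the functions \<open>D n\<close> themselves have no common majorant.\<close>

lemma integral_powr_add_min_tendsto:
  fixes s :: "'a \<Rightarrow> real" and D :: "nat \<Rightarrow> 'a \<Rightarrow> real"
  assumes [measurable]: "s \<in> borel_measurable M" "\<And>n. D n \<in> borel_measurable M"
    and s: "\<And>x. 0 \<le> s x" and D: "\<And>n x. 0 \<le> D n x" and p: "0 \<le> p"
    and int: "integrable M (\<lambda>x. s x powr p)"
    and lim: "AE x in M. (\<lambda>n. D n x) \<longlonglongrightarrow> 0"
  shows "(\<lambda>n. \<integral>x. (s x + min (s x) (D n x)) powr p - s x powr p \<partial>M) \<longlonglongrightarrow> 0"
proof -
  have "(\<lambda>n. \<integral>x. (s x + min (s x) (D n x)) powr p - s x powr p \<partial>M) \<longlonglongrightarrow> (\<integral>x. 0 \<partial>M)"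
  proof (rule integral_dominated_convergence[where w="\<lambda>x. 2 powr p * s x powr p"])
    show "integrable M (\<lambda>x. 2 powr p * s x powr p)"
      using int by simp
    show "AE x in M. (\<lambda>n. (s x + min (s x) (D n x)) powr p - s x powr p) \<longlonglongrightarrow> 0"
      using lim
    proof eventually_elim
      case (elim x)
      show ?case
      \<comment> \<open>Continuity of \<open>powr\<close> is used at a nonzero base; where s
        vanishes, the cap makes the whole expression identically 0.\<close>
      proof (cases "s x = 0")
        case False
        have "(\<lambda>n. (s x + min (s x) (D n x)) powr p - s x powr p) \<longlonglongrightarrow> (s x + min (s x) 0) powr p - s x powr p"
          using False s[of x] by (intro tendsto_intros elim) auto
        then show ?thesis
          using s[of x] by simp
      qed (simp add: D min_absorb1)
    qed
    show "AE x in M. norm ((s x + min (s x) (D n x)) powr p - s x powr p) \<le> 2 powr p * s x powr p" for n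
    proof (rule AE_I2)
      fix x
      have "s x powr p \<le> (s x + min (s x) (D n x)) powr p"
        using s D p by (intro powr_mono2) (auto simp: min_def)
      moreover have "(s x + min (s x) (D n x)) powr p \<le> (2 * s x) powr p"
        using s D p by (intro powr_mono2) (auto simp: min_def)
      moreover have "(2 * s x) powr p = 2 powr p * s x powr p"
        using s by (simp add: powr_mult)
      ultimately show "norm ((s x + min (s x) (D n x)) powr p - s x powr p) \<le> 2 powr p * s x powr p"
        using powr_ge_zero[of "s x" p] unfolding real_norm_def by linarith
    qed
  qed measurable
  then show ?thesis
    by simp
qed

text \<open>Each new term adds its own p-th power, up to the factor 2^p, plus an interaction of at
  most 1. So p-th powers of norms add up as for disjoint functions, which gives linear growth in
  m.\<close>

lemma integral_powr_sum_le:
  fixes D :: "nat \<Rightarrow> 'a \<Rightarrow> real"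
  assumes [measurable]: "\<And>n. D n \<in> borel_measurable M"
    and D: "\<And>n x. 0 \<le> D n x" and p: "0 < p"
    and int: "\<And>n. integrable M (\<lambda>x. D n x powr p)"
    and C: "\<And>n. (\<integral>x. D n x powr p \<partial>M) \<le> C"
    and step: "\<And>k. (\<integral>x. ((\<Sum>i<k. D (r i) x) + min (\<Sum>i<k. D (r i) x) (D (r k) x)) powr p
        - (\<Sum>i<k. D (r i) x) powr p \<partial>M) \<le> 1"
  shows "integrable M (\<lambda>x. (\<Sum>k<m. D (r k) x) powr p)"
    and "(\<integral>x. (\<Sum>k<m. D (r k) x) powr p \<partial>M) \<le> real m * (2 powr p * C + 1)"
proof -
  define S where "S m x = (\<Sum>k<m. D (r k) x)" for m x
  have [measurable]: "S m \<in> borel_measurable M" for m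
    unfolding S_def[abs_def] by measurable
  have S0: "0 \<le> S m x" for m x
    by (simp add: S_def sum_nonneg D)
  have SS: "S (Suc m) x = S m x + D (r m) x" for m x
    by (simp add: S_def)
  have Sint: "integrable M (\<lambda>x. S m x powr p)" for m
    unfolding S_def using D p int by (intro integrable_powr_sum) auto
  then show "integrable M (\<lambda>x. (\<Sum>k<m. D (r k) x) powr p)"
    by (simp add: S_def)
  have "(\<integral>x. S m x powr p \<partial>M) \<le> real m * (2 powr p * C + 1)"
  proof (induction m)
    case 0
    then show ?case by (simp add: S_def)
  next
    case (Suc m)
    have i1: "integrable M (\<lambda>x. (S m x + min (S m x) (D (r m) x)) powr p - S m x powr p)"
    proof (rule Bochner_Integration.integrable_bound)
      show "integrable M (\<lambda>x. 2 powr p * S m x powr p)"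
        using Sint by simp
      show "AE x in M. norm ((S m x + min (S m x) (D (r m) x)) powr p - S m x powr p) \<le> norm (2 powr p * S m x powr p)"
      proof (rule AE_I2)
        fix x
        have "S m x powr p \<le> (S m x + min (S m x) (D (r m) x)) powr p"
          using S0 D p by (intro powr_mono2) (auto simp: min_def)
        moreover have "(S m x + min (S m x) (D (r m) x)) powr p \<le> (2 * S m x) powr p"
          using S0 D p by (intro powr_mono2) (auto simp: min_def)
        moreover have "(2 * S m x) powr p = 2 powr p * S m x powr p"
          using S0 by (simp add: powr_mult)
        ultimately show "norm ((S m x + min (S m x) (D (r m) x)) powr p - S m x powr p) \<le> norm (2 powr p * S m x powr p)"
          using powr_ge_zero[of "S m x" p] unfolding real_norm_def by linarith
      qed
    qed measurable
    have "(\<integral>x. S (Suc m) x powr p \<partial>M) \<le> (\<integral>x. S m x powr p + 2 powr p * D (r m) x powr p +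
        ((S m x + min (S m x) (D (r m) x)) powr p - S m x powr p) \<partial>M)"
    proof (intro integral_mono Sint)
      show "integrable M (\<lambda>x. S m x powr p + 2 powr p * D (r m) x powr p +
        ((S m x + min (S m x) (D (r m) x)) powr p - S m x powr p))"
        using i1 Sint int by (intro Bochner_Integration.integrable_add integrable_mult_right)
    qed (use powr_add_le_min[OF S0 D] p in \<open>simp add: SS\<close>)
    also have "\<dots> = (\<integral>x. S m x powr p \<partial>M) + 2 powr p * (\<integral>x. D (r m) x powr p \<partial>M) +
        (\<integral>x. (S m x + min (S m x) (D (r m) x)) powr p - S m x powr p \<partial>M)"
      using i1 Sint[of m] int[of "r m"]
      by (subst Bochner_Integration.integral_add) (auto intro!: Bochner_Integration.integrable_add integrable_mult_right)
    also have "\<dots> \<le> real m * (2 powr p * C + 1) + 2 powr p * C + 1"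
      using step[of m] by (intro add_mono Suc.IH mult_left_mono C) (auto simp: S_def)
    finally show ?case
      by (simp add: algebra_simps)
  qed
  then show "(\<integral>x. (\<Sum>k<m. D (r k) x) powr p \<partial>M) \<le> real m * (2 powr p * C + 1)"
    by (simp add: S_def)
qed

text \<open>This is the gain from p > 1: at p = 1 the quotient equals C for every m > 0.\<close>

lemma tendsto_powr_times_over:
  fixes p C :: real
  assumes "1 < p"
  shows "(\<lambda>m. real m * C / real m powr p) \<longlonglongrightarrow> 0"
proof -
  have "(\<lambda>m. C * real m powr (1 - p)) \<longlonglongrightarrow> C * 0"
    using assms by (intro tendsto_mult tendsto_const tendsto_neg_powr filterlim_real_sequentially) auto
  moreover have "\<forall>\<^sub>F m in sequentially. C * real m powr (1 - p) = real m * C / real m powr p"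
    using eventually_gt_at_top[of 0] by eventually_elim (simp add: powr_diff)
  ultimately show ?thesis
    by (simp add: tendsto_cong)
qed

text \<open>Young's inequality for a and b^(p - 1), multiplied by p so that the case p = 1, which
  has no finite conjugate exponent, is included.\<close>

lemma young_powr:
  fixes a b p :: real
  assumes "0 \<le> a" "0 \<le> b" "1 \<le> p"
  shows "p * (b powr (p - 1) * a) \<le> a powr p + (p - 1) * b powr p"
proof (cases "p = 1")
  case True
  then show ?thesis
    using assms by simp
next
  case False
  define q where "q = p / (p - 1)"
  have pq: "1 < p" "1 < q" "1 / p + 1 / q = 1"
    using assms False by (auto simp: q_def field_simps)
  have "a * b powr (p - 1) \<le> a powr p / p + (b powr (p - 1)) powr q / q"
    using assms by (intro Youngs_inequality pq) auto
  also have "(b powr (p - 1)) powr q = b powr p"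
    using pq by (simp add: powr_powr q_def)
  finally have "p * (a * b powr (p - 1)) \<le> p * (a powr p / p + b powr p / q)"
    using pq by (intro mult_left_mono) auto
  also have "\<dots> = a powr p + (p - 1) * b powr p"
    using pq by (simp add: q_def field_simps)
  finally show ?thesis
    by (simp add: mult.commute)
qed

section \<open>Borel representatives and functionals\<close>

text \<open>
  The endpoint \<open>1\<close> is left out of \<open>J\<close>: a function in \<open>Ces p {0..1}\<close> need not be integrable near \<open>1\<close>, so
  \<open>cumulative f 1\<close> below may be a junk value.
\<close>

locale cesaro_interval =
  fixes p :: real and I J :: "real set"
  assumes p: "1 \<le> p"
    and IJ: "(I = {0..1} \<and> J = {0<..<1}) \<or> (I = {0..} \<and> J = {0<..})"
begin

definition cumulative :: "(real \<Rightarrow> real) \<Rightarrow> real \<Rightarrow> real" where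
  "cumulative f x = (\<integral>t. indicator {0..x} t * \<bar>f t\<bar> \<partial>lborel)"

definition avg :: "(real \<Rightarrow> real) \<Rightarrow> real \<Rightarrow> real" where
  "avg f x = cumulative f x / x"

definition ces_norm :: "(real \<Rightarrow> real) \<Rightarrow> real" where
  "ces_norm f = (\<integral>x. indicator J x * avg f x powr p \<partial>lborel) powr (1 / p)"

text \<open>Borel measurability lets all integrals be taken over \<open>lborel\<close>, where
  Tonelli applies. Vanishing off \<open>J\<close> turns almost everywhere equality on
  \<open>I\<close> into almost everywhere equality on the line.\<close>

definition borel_rep :: "(real \<Rightarrow> real) \<Rightarrow> bool" where
  "borel_rep f \<longleftrightarrow> f \<in> borel_measurable borel \<and> f \<in> cesaro_functions p I \<and> (\<forall>x. x \<notin> J \<longrightarrow> f x = 0)"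

abbreviation cls :: "(real \<Rightarrow> real) \<Rightarrow> (real \<Rightarrow> real) set" where
  "cls f \<equiv> cesaro_rel p I `` {f}"

lemma I_cases: "I = {0..1} \<or> I = {0..}"
  using IJ by auto

lemma I_sets [measurable]: "I \<in> sets borel" "I \<in> sets lebesgue"
  using IJ by auto

lemma J_sets [measurable]: "J \<in> sets borel"
  using IJ by auto

lemma J_pos: "x \<in> J \<Longrightarrow> 0 < x"
  using IJ by auto

lemma J_subset: "x \<in> J \<Longrightarrow> x \<in> I"
  using IJ by auto

lemma J_downward: "x \<in> J \<Longrightarrow> 0 < y \<Longrightarrow> y \<le> x \<Longrightarrow> y \<in> J"
  using IJ by auto

lemma J_larger:
  assumes "x \<in> J"
  obtains y where "y \<in> J" "x < y"
  using IJ
proof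
  assume *: "I = {0..1} \<and> J = {0<..<1}"
  show ?thesis
    using assms * by (intro that[of "(x + 1) / 2"]) auto
next
  assume *: "I = {0..} \<and> J = {0<..}"
  show ?thesis
    using assms * by (intro that[of "x + 1"]) auto
qed

lemma AE_I_J: "AE x in lborel. x \<in> I \<longrightarrow> x \<in> J"
  using AE_lborel_singleton[of 0] AE_lborel_singleton[of 1]
  by eventually_elim (use IJ in auto)

lemma AE_lebesgue_on_I_iff: "(AE x in lebesgue_on I. P x) \<longleftrightarrow> (AE x in lborel. x \<in> I \<longrightarrow> P x)"
proof -
  have "(AE x in lebesgue_on I. P x) \<longleftrightarrow> (AE x in lebesgue. x \<in> I \<longrightarrow> P x)"
    by (rule AE_restrict_space_iff) simp
  then show ?thesis
    by (simp only: AE_completion_iff)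
qed

lemma borel_rep_measurable [measurable_dest]: "borel_rep f \<Longrightarrow> f \<in> borel_measurable borel"
  by (simp add: borel_rep_def)

lemma borel_rep_zero_outside: "borel_rep f \<Longrightarrow> x \<notin> J \<Longrightarrow> f x = 0"
  by (simp add: borel_rep_def)

lemma borel_rep_representative:
  assumes "A \<in> ns_carrier (Ces p I)"
  obtains f where "borel_rep f" "A = cls f"
proof -
  obtain f0 where f0: "f0 \<in> cesaro_functions p I" "A = cls f0"
    using assms by (auto simp: Ces_carrier_iff)
  then have "f0 \<in> borel_measurable (lebesgue_on I)"
    by (simp add: cesaro_functions_def)
  then have "(\<lambda>x. indicator I x *\<^sub>R f0 x) \<in> borel_measurable lebesgue"
    by (subst (asm) borel_measurable_restrict_space_iff) auto
  from completion_ex_borel_measurable_real[OF this]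
  obtain g where g: "g \<in> borel_measurable lborel" "AE x in lborel. indicator I x *\<^sub>R f0 x = g x"
    by blast
  have [measurable]: "g \<in> borel_measurable borel"
    using g(1) by simp
  define f where "f x = indicator J x * g x" for x
  have f_meas: "f \<in> borel_measurable borel"
    unfolding f_def[abs_def] by measurable
  have "AE x in lborel. x \<in> I \<longrightarrow> f0 x = f x"
    using g(2) AE_I_J by eventually_elim (auto simp: f_def)
  then have ae: "AE x in lebesgue_on I. f0 x = f x"
    by (simp add: AE_lebesgue_on_I_iff)
  have fl: "f \<in> borel_measurable (lebesgue_on I)"
    using f_meas by (intro measurable_restrict_space1 measurable_completion) simp
  have "cesaro_norm p I f = cesaro_norm p I f0"
    using cesaro_norm_cong_AE[OF ae I_cases p] by simp
  with f0 fl have fc: "f \<in> cesaro_functions p I"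
    by (simp add: cesaro_functions_def)
  have "(f0, f) \<in> cesaro_rel p I"
    using f0 fc ae by (simp add: cesaro_rel_def)
  then have "A = cls f"
    using f0(2) equiv_class_eq[OF equiv_cesaro_rel] by auto
  moreover have "borel_rep f"
    using fc f_meas by (simp add: borel_rep_def f_def)
  ultimately show ?thesis
    using that by blast
qed

lemma cls_eq_imp_AE:
  assumes "borel_rep f" "borel_rep g" "cls f = cls g"
  shows "AE x in lborel. f x = g x"
proof -
  have "(f, g) \<in> cesaro_rel p I"
    using assms by (intro eq_equiv_class[OF _ equiv_cesaro_rel]) (auto simp: borel_rep_def)
  then have "AE x in lborel. x \<in> I \<longrightarrow> f x = g x"
    by (simp add: cesaro_rel_def AE_lebesgue_on_I_iff)
  then show ?thesis
    by eventually_elim (metis assms(1,2) borel_rep_zero_outside J_subset)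
qed

lemma borel_rep_zero: "borel_rep (\<lambda>x. 0)"
  using p by (simp add: borel_rep_def cesaro_functions_zero)

lemma borel_rep_add: "borel_rep f \<Longrightarrow> borel_rep g \<Longrightarrow> borel_rep (\<lambda>x. f x + g x)"
  using p I_cases by (auto simp: borel_rep_def cesaro_functions_add)

lemma borel_rep_scale: "borel_rep f \<Longrightarrow> borel_rep (\<lambda>x. c * f x)"
  using p I_cases by (auto simp: borel_rep_def cesaro_functions_scale)

lemma borel_rep_sum: "(\<And>k. borel_rep (f k)) \<Longrightarrow> borel_rep (\<lambda>x. \<Sum>k<m. f k x)" for m :: nat
  by (induction m) (auto simp: borel_rep_zero borel_rep_add)

lemma ns_sum_cls:
  assumes "\<And>k. borel_rep (f k)"
  shows "ns_sum (Ces p I) (\<lambda>k. cls (f k)) m = cls (\<lambda>x. \<Sum>k<m. f k x)"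
proof (induction m)
  case 0
  show ?case by (simp add: Ces_def)
next
  case (Suc m)
  have "(\<lambda>x. \<Sum>k<m. f k x) \<in> cesaro_functions p I" "f m \<in> cesaro_functions p I"
    using borel_rep_sum[of f m] assms by (auto simp: borel_rep_def)
  then show ?case
    using Suc by (simp add: Ces_add_class I_cases p)
qed

text \<open>Only z in \<open>[x, y]\<close> is kept: there the integral over \<open>[0, z]\<close>
  is at least that over \<open>[0, x]\<close>, and it is divided by at most y. Room to the right of
  x is essential, and this is how finiteness of the norm forces integrability on
  \<open>[0, x]\<close>.\<close>

lemma cesaro_integral_lower_bound:
  assumes "0 < x" "x < y" "y \<in> J"
  shows "ennreal (y - x) * ennreal_powr ((\<integral>\<^sup>+t\<in>{0..x}. ennreal \<bar>f t\<bar> \<partial>lebesgue) / ennreal y) p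
    \<le> (\<integral>\<^sup>+z\<in>I. ennreal_powr (cesaro_mean f z) p \<partial>lebesgue)"
proof -
  let ?F = "\<lambda>x. \<integral>\<^sup>+t\<in>{0..x}. ennreal \<bar>f t\<bar> \<partial>lebesgue"
  let ?c = "ennreal_powr (?F x / ennreal y) p"
  have "ennreal (y - x) * ?c = (\<integral>\<^sup>+z. ?c * indicator {x..y} z \<partial>lebesgue)"
    using assms by (subst nn_integral_cmult_indicator) (auto simp: mult.commute)
  also have "\<dots> \<le> (\<integral>\<^sup>+z\<in>I. ennreal_powr (cesaro_mean f z) p \<partial>lebesgue)"
  proof (intro nn_integral_mono)
    fix z
    show "?c * indicator {x..y} z \<le> ennreal_powr (cesaro_mean f z) p * indicator I z"
    proof (cases "z \<in> {x..y}")
      case True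
      then have z: "x \<le> z" "z \<le> y" "0 < z" "z \<in> I"
        using assms J_subset[OF J_downward[of y z]] by auto
      have "?F x / ennreal y \<le> ?F z / ennreal y"
        by (intro divide_right_mono_ennreal monoD[OF mono_cesaro_integral] z)
      also have "\<dots> \<le> ?F z / ennreal z"
        using z by (auto simp: divide_ennreal_def inverse_ennreal intro!: mult_left_mono ennreal_leI le_imp_inverse_le)
      finally have "?c \<le> ennreal_powr (cesaro_mean f z) p"
        using p unfolding cesaro_mean_def by (intro ennreal_powr_mono) auto
      with True z show ?thesis
        by simp
    qed simp
  qed
  finally show ?thesis .
qed

lemma borel_rep_integral_finite:
  assumes "borel_rep f"
  shows "(\<integral>\<^sup>+z\<in>I. ennreal_powr (cesaro_mean f z) p \<partial>lebesgue) < \<infinity>"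
proof -
  have "cesaro_norm p I f < \<infinity>"
    using assms by (simp add: borel_rep_def cesaro_functions_def)
  then show ?thesis
    unfolding cesaro_norm_def ennreal_powr_less_top .
qed

lemma borel_rep_local_finite:
  assumes "borel_rep f" "x \<in> J"
  shows "(\<integral>\<^sup>+t\<in>{0..x}. ennreal \<bar>f t\<bar> \<partial>lebesgue) < \<infinity>"
proof (rule ccontr)
  assume "\<not> ?thesis"
  then have inf: "(\<integral>\<^sup>+t\<in>{0..x}. ennreal \<bar>f t\<bar> \<partial>lebesgue) = \<infinity>"
    by (simp add: not_less top_unique)
  obtain y where y: "y \<in> J" "x < y"
    using J_larger[OF assms(2)] .
  have "ennreal (y - x) * ennreal_powr (\<infinity> / ennreal y) p \<le> (\<integral>\<^sup>+z\<in>I. ennreal_powr (cesaro_mean f z) p \<partial>lebesgue)"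
    using cesaro_integral_lower_bound[OF J_pos[OF assms(2)] y(2,1), of f] by (simp only: inf)
  moreover have "ennreal (y - x) * ennreal_powr (\<infinity> / ennreal y) p = \<infinity>"
    using y by (simp add: ennreal_powr_def ennreal_top_divide ennreal_mult_top)
  ultimately show False
    using borel_rep_integral_finite[OF assms(1)] by simp
qed

lemma borel_rep_integrable:
  assumes "borel_rep f" "x \<in> J"
  shows "integrable lborel (\<lambda>t. indicator {0..x} t * f t)"
proof (rule integrableI_bounded)
  have [measurable]: "f \<in> borel_measurable borel"
    using assms(1) by (rule borel_rep_measurable)
  show "(\<lambda>t. indicator {0..x} t * f t) \<in> borel_measurable lborel"
    by measurable
  have "(\<integral>\<^sup>+t. ennreal (norm (indicator {0..x} t * f t)) \<partial>lborel) = (\<integral>\<^sup>+t\<in>{0..x}. ennreal \<bar>f t\<bar> \<partial>lborel)"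
    by (intro nn_integral_cong) (auto simp: indicator_def)
  also have "\<dots> < \<infinity>"
    using borel_rep_local_finite[OF assms] by (simp add: nn_integral_completion)
  finally show "(\<integral>\<^sup>+t. ennreal (norm (indicator {0..x} t * f t)) \<partial>lborel) < \<infinity>" .
qed

lemma borel_rep_integrable_abs:
  assumes "borel_rep f" "x \<in> J"
  shows "integrable lborel (\<lambda>t. indicator {0..x} t * \<bar>f t\<bar>)"
  using integrable_abs[OF borel_rep_integrable[OF assms]] by (simp add: abs_mult)

lemma nn_integral_eq_cumulative:
  assumes "borel_rep f" "x \<in> J"
  shows "(\<integral>\<^sup>+t\<in>{0..x}. ennreal \<bar>f t\<bar> \<partial>lborel) = ennreal (cumulative f x)"
proof -
  have "(\<integral>\<^sup>+t\<in>{0..x}. ennreal \<bar>f t\<bar> \<partial>lborel) = (\<integral>\<^sup>+t. ennreal (indicator {0..x} t * \<bar>f t\<bar>) \<partial>lborel)"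
    by (intro nn_integral_cong) (auto simp: indicator_def)
  also have "\<dots> = ennreal (cumulative f x)"
    unfolding cumulative_def by (intro nn_integral_eq_integral borel_rep_integrable_abs assms) auto
  finally show ?thesis .
qed

lemma cumulative_nonneg: "0 \<le> cumulative f x"
  unfolding cumulative_def by (rule Bochner_Integration.integral_nonneg) simp

lemma avg_nonneg: "0 \<le> x \<Longrightarrow> 0 \<le> avg f x"
  by (simp add: avg_def cumulative_nonneg)

lemma cumulative_mono:
  assumes "borel_rep f" "x \<le> y" "y \<in> J"
  shows "cumulative f x \<le> cumulative f y"
proof (cases "0 < x")
  case True
  then show ?thesis
    unfolding cumulative_def using assms J_downward[OF assms(3) True]
    by (intro integral_mono borel_rep_integrable_abs) (auto simp: indicator_def)
next
  case False
  have z: "f t = 0" if "t \<le> x" for t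
    using that False borel_rep_zero_outside[OF assms(1), of t] J_pos[of t] by fastforce
  have "cumulative f x = (\<integral>t. 0 \<partial>(lborel :: real measure))"
    unfolding cumulative_def
    by (intro Bochner_Integration.integral_cong refl) (auto simp: indicator_def z)
  then show ?thesis
    by (simp add: cumulative_nonneg)
qed

lemma cumulative_measurable [measurable]:
  assumes [measurable]: "f \<in> borel_measurable borel"
  shows "cumulative f \<in> borel_measurable borel"
proof -
  have "(\<lambda>x. \<integral>t. (if 0 \<le> t \<and> t \<le> x then \<bar>f t\<bar> else 0) \<partial>lborel) \<in> borel_measurable borel"
    by measurable
  moreover have "(\<lambda>x. \<integral>t. (if 0 \<le> t \<and> t \<le> x then \<bar>f t\<bar> else 0) \<partial>lborel) = cumulative f"
    unfolding cumulative_def[abs_def] by (intro ext Bochner_Integration.integral_cong) (auto simp: indicator_def)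
  ultimately show ?thesis
    by simp
qed

lemma avg_measurable [measurable]:
  assumes [measurable]: "f \<in> borel_measurable borel"
  shows "avg f \<in> borel_measurable borel"
  unfolding avg_def[abs_def] by measurable

lemma cesaro_mean_eq:
  assumes "borel_rep f" "x \<in> J"
  shows "cesaro_mean f x = ennreal (avg f x)"
  using nn_integral_eq_cumulative[OF assms] J_pos[OF assms(2)]
  by (simp add: cesaro_mean_def nn_integral_completion avg_def divide_ennreal cumulative_nonneg)

lemma cesaro_integral_eq:
  assumes f: "borel_rep f"
  shows "(\<integral>\<^sup>+z\<in>I. ennreal_powr (cesaro_mean f z) p \<partial>lebesgue) =
    (\<integral>\<^sup>+z. ennreal (indicator J z * avg f z powr p) \<partial>lborel)"
proof -
  have "AE z in lborel. ennreal_powr (cesaro_mean f z) p * indicator I z = ennreal (indicator J z * avg f z powr p)"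
    using AE_I_J
  proof eventually_elim
    case (elim z)
    show ?case
    proof (cases "z \<in> J")
      case True
      then show ?thesis
        using J_subset[OF True] J_pos[OF True] avg_nonneg[of z f]
        by (simp add: cesaro_mean_eq[OF f True] ennreal_powr_def)
    qed (use elim in auto)
  qed
  then have "(\<integral>\<^sup>+z. ennreal_powr (cesaro_mean f z) p * indicator I z \<partial>lborel) =
      (\<integral>\<^sup>+z. ennreal (indicator J z * avg f z powr p) \<partial>lborel)"
    by (rule nn_integral_cong_AE)
  then show ?thesis
    by (simp add: nn_integral_completion)
qed

lemma borel_rep_avg_integrable:
  assumes f: "borel_rep f"
  shows "integrable lborel (\<lambda>z. indicator J z * avg f z powr p)"
proof (rule integrableI_nonneg)
  have [measurable]: "f \<in> borel_measurable borel"
    using f by (rule borel_rep_measurable)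
  show "(\<lambda>z. indicator J z * avg f z powr p) \<in> borel_measurable lborel"
    by measurable
  show "(\<integral>\<^sup>+z. ennreal (indicator J z * avg f z powr p) \<partial>lborel) < \<infinity>"
    using borel_rep_integral_finite[OF f] by (simp only: cesaro_integral_eq[OF f])
qed simp

lemma ns_norm_cls:
  assumes f: "borel_rep f"
  shows "ns_norm (Ces p I) (cls f) = ces_norm f"
proof -
  have "ns_norm (Ces p I) (cls f) = enn2real (cesaro_norm p I f)"
    using f by (intro Ces_norm_class I_cases p) (simp add: borel_rep_def)
  also have "cesaro_norm p I f = ennreal (ces_norm f)"
    unfolding cesaro_norm_def cesaro_integral_eq[OF f] ces_norm_def
    by (subst nn_integral_eq_integral[OF borel_rep_avg_integrable[OF f]])
      (auto simp: ennreal_powr_def Bochner_Integration.integral_nonneg)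
  finally show ?thesis
    by (simp add: ces_norm_def)
qed

lemma ces_norm_nonneg: "0 \<le> ces_norm f"
  by (simp add: ces_norm_def)

lemma ces_norm_powr: "ces_norm f powr p = (\<integral>x. indicator J x * avg f x powr p \<partial>lborel)"
proof -
  have "0 \<le> (\<integral>x. indicator J x * avg f x powr p \<partial>lborel)"
    by (rule Bochner_Integration.integral_nonneg) simp
  then show ?thesis
    using p by (simp add: ces_norm_def powr_powr)
qed

text \<open>The estimate (y - x) (F(x) / y)^p \<le> norm^p, solved for F(x) =
  \<open>cumulative f x\<close>, gives C = y (y - x)^(- 1 / p). As C is independent of f,
  restriction to \<open>[0, x]\<close> is bounded into \<open>L\<^sub>1\<close>.\<close>

lemma cumulative_bound:
  assumes x: "x \<in> J"
  obtains C where "0 \<le> C" "\<And>f. borel_rep f \<Longrightarrow> cumulative f x \<le> C * ces_norm f"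
proof -
  obtain y where y: "y \<in> J" "x < y"
    using J_larger[OF x] .
  have x0: "0 < x"
    using J_pos[OF x] .
  define c where "c = 1 / (y - x)"
  have c: "0 \<le> c"
    using y by (simp add: c_def)
  define C where "C = y * c powr (1 / p)"
  show ?thesis
  proof
    show "0 \<le> C"
      using y x0 by (simp add: C_def)
    fix f assume f: "borel_rep f"
    let ?a = "cumulative f x / y"
    have a0: "0 \<le> ?a"
      using y x0 by (simp add: cumulative_nonneg)
    have "(\<integral>z. indicator {x..y} z * ?a powr p \<partial>lborel) \<le> (\<integral>z. indicator J z * avg f z powr p \<partial>lborel)"
    proof (intro integral_mono borel_rep_avg_integrable f)
      show "integrable lborel (\<lambda>z. indicator {x..y} z * ?a powr p)"
        by (intro integrable_mult_left integrable_real_indicator) (auto simp: emeasure_lborel_Icc_eq)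
      fix z
      show "indicator {x..y} z * ?a powr p \<le> indicator J z * avg f z powr p"
      proof (cases "z \<in> {x..y}")
        case True
        then have z: "z \<in> J" "0 < z" "x \<le> z" "z \<le> y"
          using x0 J_downward[OF y(1)] by auto
        have "?a \<le> avg f z"
          unfolding avg_def using z by (intro frac_le cumulative_nonneg cumulative_mono f) auto
        then show ?thesis
          using z True a0 p by (simp add: powr_mono2)
      qed simp
    qed
    then have "(y - x) * ?a powr p \<le> ces_norm f powr p"
      using y by (simp add: ces_norm_powr)
    then have "?a powr p \<le> ces_norm f powr p * c"
      using y by (simp add: c_def field_simps)
    then have "(?a powr p) powr (1 / p) \<le> (ces_norm f powr p * c) powr (1 / p)"
      using p by (intro powr_mono2) auto
    moreover have "(?a powr p) powr (1 / p) = ?a"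
    proof -
      have "p * (1 / p) = 1"
        using p by simp
      then show ?thesis
        by (simp only: powr_powr powr_one[OF a0])
    qed
    moreover have "(ces_norm f powr p * c) powr (1 / p) = ces_norm f * c powr (1 / p)"
      using p c ces_norm_nonneg[of f] by (simp add: powr_mult powr_powr)
    ultimately have "?a \<le> ces_norm f * c powr (1 / p)"
      by simp
    then show "cumulative f x \<le> C * ces_norm f"
      using y x0 by (simp add: C_def field_simps)
  qed
qed

section \<open>Functionals given by integral kernels\<close>

definition pairing :: "(real \<Rightarrow> real) \<Rightarrow> (real \<Rightarrow> real) set \<Rightarrow> real" where
  "pairing g A = (\<integral>x. (SOME f. borel_rep f \<and> A = cls f) x * g x \<partial>lborel)"

lemma pairing_cls:
  assumes f: "borel_rep f" and [measurable]: "g \<in> borel_measurable borel"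
  shows "pairing g (cls f) = (\<integral>x. f x * g x \<partial>lborel)"
proof -
  define h where "h = (SOME h. borel_rep h \<and> cls f = cls h)"
  have "borel_rep h \<and> cls f = cls h"
    unfolding h_def by (rule someI[of _ f]) (use f in simp)
  then have h: "borel_rep h" "cls f = cls h"
    by blast+
  have [measurable]: "f \<in> borel_measurable borel" "h \<in> borel_measurable borel"
    using f h(1) by (auto intro: borel_rep_measurable)
  have "AE x in lborel. h x * g x = f x * g x"
    using cls_eq_imp_AE[OF f h] by eventually_elim simp
  then show ?thesis
    unfolding pairing_def h_def[symmetric] by (intro integral_cong_AE) auto
qed

lemma pairing_dual:
  assumes g[measurable]: "g \<in> borel_measurable borel"
    and int: "\<And>f. borel_rep f \<Longrightarrow> integrable lborel (\<lambda>x. f x * g x)"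
    and bound: "\<And>f. borel_rep f \<Longrightarrow> \<bar>\<integral>x. f x * g x \<partial>lborel\<bar> \<le> C * ces_norm f"
  shows "pairing g \<in> ns_dual (Ces p I)"
proof -
  have "pairing g (ns_add (Ces p I) u v) = pairing g u + pairing g v"
    if u: "u \<in> ns_carrier (Ces p I)" and v: "v \<in> ns_carrier (Ces p I)" for u v
  proof -
    obtain f where f: "borel_rep f" "u = cls f"
      using borel_rep_representative[OF u] .
    obtain h where h: "borel_rep h" "v = cls h"
      using borel_rep_representative[OF v] .
    have "ns_add (Ces p I) u v = cls (\<lambda>x. f x + h x)"
      using f h I_cases p by (simp add: Ces_add_class borel_rep_def)
    then show ?thesis
      using f h int[OF f(1)] int[OF h(1)] by (simp add: pairing_cls borel_rep_add g distrib_right)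
  qed
  moreover have "pairing g (ns_scale (Ces p I) c u) = c * pairing g u"
    if u: "u \<in> ns_carrier (Ces p I)" for c u
  proof -
    obtain f where f: "borel_rep f" "u = cls f"
      using borel_rep_representative[OF u] .
    have "ns_scale (Ces p I) c u = cls (\<lambda>x. c * f x)"
      using f I_cases p by (simp add: Ces_scale_class borel_rep_def)
    then show ?thesis
      using f int[OF f(1)] by (simp add: pairing_cls borel_rep_scale g mult.assoc)
  qed
  moreover have "\<bar>pairing g u\<bar> \<le> C * ns_norm (Ces p I) u" if u: "u \<in> ns_carrier (Ces p I)" for u
  proof -
    obtain f where f: "borel_rep f" "u = cls f"
      using borel_rep_representative[OF u] .
    then show ?thesis
      using bound[OF f(1)] by (simp add: pairing_cls g ns_norm_cls)
  qed
  ultimately show ?thesis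
    unfolding ns_dual_def by blast
qed

text \<open>
  The transpose of the averaging operator. It may take the value \<open>\<infinity>\<close>, but only where every function
  it is paired with vanishes, so that \<open>enn2real\<close> does no harm.
\<close>

definition weight :: "(real \<Rightarrow> real) \<Rightarrow> real \<Rightarrow> ennreal" where
  "weight k t = (\<integral>\<^sup>+x. ennreal (if t \<le> x \<and> x \<in> J then k x / x else 0) \<partial>lborel)"

lemma weight_measurable [measurable]:
  assumes [measurable]: "k \<in> borel_measurable borel"
  shows "weight k \<in> borel_measurable borel"
  unfolding weight_def[abs_def] by measurable

lemma weight_Tonelli:
  assumes [measurable]: "k \<in> borel_measurable borel" and k: "\<And>x. x \<in> J \<Longrightarrow> 0 \<le> k x" and h: "borel_rep h"
  shows "(\<integral>\<^sup>+t. ennreal \<bar>h t\<bar> * weight k t \<partial>lborel) = (\<integral>\<^sup>+x. ennreal (indicator J x * (k x * avg h x)) \<partial>lborel)"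
proof -
  have [measurable]: "h \<in> borel_measurable borel"
    using h by (rule borel_rep_measurable)
  let ?g = "\<lambda>t x. ennreal \<bar>h t\<bar> * ennreal (if t \<le> x \<and> x \<in> J then k x / x else 0)"
  have "(\<integral>\<^sup>+t. ennreal \<bar>h t\<bar> * weight k t \<partial>lborel) = (\<integral>\<^sup>+t. \<integral>\<^sup>+x. ?g t x \<partial>lborel \<partial>lborel)"
    unfolding weight_def by (intro nn_integral_cong nn_integral_cmult[symmetric]) measurable
  also have "\<dots> = (\<integral>\<^sup>+x. \<integral>\<^sup>+t. ?g t x \<partial>lborel \<partial>lborel)"
    by (rule lborel_pair.Fubini'[symmetric]) measurable
  also have "\<dots> = (\<integral>\<^sup>+x. ennreal (indicator J x * (k x * avg h x)) \<partial>lborel)"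
  proof (intro nn_integral_cong)
    fix x
    show "(\<integral>\<^sup>+t. ?g t x \<partial>lborel) = ennreal (indicator J x * (k x * avg h x))"
    proof (cases "x \<in> J")
      case True
      have "?g t x = ennreal (k x / x) * (ennreal \<bar>h t\<bar> * indicator {0..x} t)" for t
      \<comment> \<open>The kernel of \<open>weight\<close> imposes only t \<le> x; negative t
        contribute nothing because h vanishes off \<open>J\<close>.\<close>
      proof (cases "0 \<le> t")
        case False
        then have "h t = 0"
          using borel_rep_zero_outside[OF h, of t] J_pos[of t] by auto
        then show ?thesis
          by simp
      qed (use True in \<open>auto simp: indicator_def mult.commute\<close>)
      then have "(\<integral>\<^sup>+t. ?g t x \<partial>lborel) = (\<integral>\<^sup>+t. ennreal (k x / x) * (ennreal \<bar>h t\<bar> * indicator {0..x} t) \<partial>lborel)"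
        by simp
      also have "\<dots> = ennreal (k x / x) * (\<integral>\<^sup>+t. ennreal \<bar>h t\<bar> * indicator {0..x} t \<partial>lborel)"
        by (intro nn_integral_cmult) measurable
      also have "\<dots> = ennreal (k x / x) * ennreal (cumulative h x)"
        by (simp only: nn_integral_eq_cumulative[OF h True])
      also have "\<dots> = ennreal (k x / x * cumulative h x)"
        using k[OF True] J_pos[OF True] by (intro ennreal_mult[symmetric] cumulative_nonneg) auto
      finally show ?thesis
        using True by (simp add: avg_def)
    qed simp
  qed
  finally show ?thesis .
qed

lemma weight_functional:
  assumes k_meas[measurable]: "k \<in> borel_measurable borel" and k: "\<And>x. x \<in> J \<Longrightarrow> 0 \<le> k x"
    and bound: "\<And>h. borel_rep h \<Longrightarrow> (\<integral>\<^sup>+x. ennreal (indicator J x * (k x * avg h x)) \<partial>lborel) \<le> ennreal (C * ces_norm h)"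
    and C: "0 \<le> C"
    and h: "borel_rep h"
  shows "(\<integral>\<^sup>+t. ennreal (\<bar>h t\<bar> * enn2real (weight k t)) \<partial>lborel) = (\<integral>\<^sup>+x. ennreal (indicator J x * (k x * avg h x)) \<partial>lborel)"
    and "integrable lborel (\<lambda>t. \<bar>h t\<bar> * enn2real (weight k t))"
    and "(\<integral>t. \<bar>h t\<bar> * enn2real (weight k t) \<partial>lborel) \<le> C * ces_norm h"
proof -
  have [measurable]: "h \<in> borel_measurable borel"
    using h by (rule borel_rep_measurable)
  note T = weight_Tonelli[OF k_meas k h]
  have le: "(\<integral>\<^sup>+t. ennreal \<bar>h t\<bar> * weight k t \<partial>lborel) \<le> ennreal (C * ces_norm h)"
    using bound[OF h] by (simp only: T)
  then have "(\<integral>\<^sup>+t. ennreal \<bar>h t\<bar> * weight k t \<partial>lborel) \<noteq> \<infinity>"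
    by (auto simp: top_unique)
  then have "AE t in lborel. ennreal \<bar>h t\<bar> * weight k t \<noteq> \<infinity>"
    by (intro nn_integral_PInf_AE) measurable
  then have "AE t in lborel. ennreal (\<bar>h t\<bar> * enn2real (weight k t)) = ennreal \<bar>h t\<bar> * weight k t"
  proof eventually_elim
    case (elim t)
    show ?case
    proof (cases "h t = 0")
      case False
      then have "weight k t < top"
        using elim by (auto simp: ennreal_mult_eq_top_iff less_top)
      then show ?thesis
        by (simp add: ennreal_mult)
    qed simp
  qed
  then have "(\<integral>\<^sup>+t. ennreal (\<bar>h t\<bar> * enn2real (weight k t)) \<partial>lborel) = (\<integral>\<^sup>+t. ennreal \<bar>h t\<bar> * weight k t \<partial>lborel)"
    by (rule nn_integral_cong_AE)
  then show eq: "(\<integral>\<^sup>+t. ennreal (\<bar>h t\<bar> * enn2real (weight k t)) \<partial>lborel) = (\<integral>\<^sup>+x. ennreal (indicator J x * (k x * avg h x)) \<partial>lborel)"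
    by (simp only: T)
  then have le': "(\<integral>\<^sup>+t. ennreal (\<bar>h t\<bar> * enn2real (weight k t)) \<partial>lborel) \<le> ennreal (C * ces_norm h)"
    using bound[OF h] by simp
  show int: "integrable lborel (\<lambda>t. \<bar>h t\<bar> * enn2real (weight k t))"
  proof (rule integrableI_nonneg)
    show "(\<integral>\<^sup>+t. ennreal (\<bar>h t\<bar> * enn2real (weight k t)) \<partial>lborel) < \<infinity>"
      using le' by (rule le_less_trans) simp
    show "(\<lambda>t. \<bar>h t\<bar> * enn2real (weight k t)) \<in> borel_measurable lborel"
      by measurable
  qed simp
  show "(\<integral>t. \<bar>h t\<bar> * enn2real (weight k t) \<partial>lborel) \<le> C * ces_norm h"
    using le' C ces_norm_nonneg[of h] by (subst (asm) nn_integral_eq_integral[OF int]) auto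
qed

text \<open>The bounded factor \<open>s\<close> takes three forms later: signs, for norming
  functionals; indicators, for equi-integrability; clamped partial sums, for almost
  orthogonality.\<close>

lemma dominated_dual:
  assumes [measurable]: "s \<in> borel_measurable borel" "v \<in> borel_measurable borel"
    and s: "\<And>x. \<bar>s x\<bar> \<le> c" and v: "\<And>x. 0 \<le> v x"
    and int: "\<And>f. borel_rep f \<Longrightarrow> integrable lborel (\<lambda>x. \<bar>f x\<bar> * v x)"
    and bound: "\<And>f. borel_rep f \<Longrightarrow> (\<integral>x. \<bar>f x\<bar> * v x \<partial>lborel) \<le> C * ces_norm f"
  shows "pairing (\<lambda>x. s x * v x) \<in> ns_dual (Ces p I)"
    and "borel_rep f \<Longrightarrow> \<bar>\<integral>x. f x * (s x * v x) \<partial>lborel\<bar> \<le> c * C * ces_norm f"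
    and "borel_rep f \<Longrightarrow> integrable lborel (\<lambda>x. f x * (s x * v x))"
proof -
  have c: "0 \<le> c"
    using s[of 0] by linarith
  have le: "\<bar>f x * (s x * v x)\<bar> \<le> c * (\<bar>f x\<bar> * v x)" for f x
  proof -
    have "\<bar>s x\<bar> * (\<bar>f x\<bar> * v x) \<le> c * (\<bar>f x\<bar> * v x)"
      using s v by (intro mult_right_mono) auto
    then show ?thesis
      using v[of x] by (simp add: abs_mult mult_ac)
  qed
  show *: "integrable lborel (\<lambda>x. f x * (s x * v x))" if f: "borel_rep f" for f
  proof (rule Bochner_Integration.integrable_bound)
    have [measurable]: "f \<in> borel_measurable borel"
      using f by (rule borel_rep_measurable)
    show "integrable lborel (\<lambda>x. c * (\<bar>f x\<bar> * v x))"
      using int[OF f] by simp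
    show "AE x in lborel. norm (f x * (s x * v x)) \<le> norm (c * (\<bar>f x\<bar> * v x))"
    proof (rule AE_I2)
      fix x
      show "norm (f x * (s x * v x)) \<le> norm (c * (\<bar>f x\<bar> * v x))"
        using le[of f x] unfolding real_norm_def by linarith
    qed
  qed (use borel_rep_measurable[OF f] in measurable)
  show **: "\<bar>\<integral>x. f x * (s x * v x) \<partial>lborel\<bar> \<le> c * C * ces_norm f" if f: "borel_rep f" for f
  proof -
    have "\<bar>\<integral>x. f x * (s x * v x) \<partial>lborel\<bar> \<le> (\<integral>x. \<bar>f x * (s x * v x)\<bar> \<partial>lborel)"
      by (rule integral_abs_bound)
    also have "\<dots> \<le> (\<integral>x. c * (\<bar>f x\<bar> * v x) \<partial>lborel)"
      using * int f by (intro integral_mono le integrable_abs integrable_mult_right) auto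
    also have "\<dots> \<le> c * (C * ces_norm f)"
      using bound[OF f] c by (simp add: mult_left_mono)
    finally show ?thesis
      by (simp add: mult.assoc)
  qed
  show "pairing (\<lambda>x. s x * v x) \<in> ns_dual (Ces p I)"
    by (rule pairing_dual[where C="c * C"]) (use * ** in auto)
qed

lemma avg_powr_integral_le:
  assumes h: "borel_rep h" and H: "ces_norm h \<le> H" "0 < H"
  shows "(\<integral>x. indicator J x * (avg h x / H) powr p \<partial>lborel) \<le> 1"
    and "integrable lborel (\<lambda>x. indicator J x * (avg h x / H) powr p)"
proof -
  have eq: "indicator J x * (avg h x / H) powr p = indicator J x * avg h x powr p / H powr p" for x
    using H avg_nonneg[of x h] J_pos[of x] by (cases "x \<in> J") (auto simp: powr_divide)
  show "integrable lborel (\<lambda>x. indicator J x * (avg h x / H) powr p)"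
    unfolding eq using borel_rep_avg_integrable[OF h] by simp
  have "(\<integral>x. indicator J x * (avg h x / H) powr p \<partial>lborel) = ces_norm h powr p / H powr p"
    unfolding eq by (simp add: ces_norm_powr)
  also have "\<dots> \<le> 1"
    using H p ces_norm_nonneg[of h] by (simp add: powr_mono2)
  finally show "(\<integral>x. indicator J x * (avg h x / H) powr p \<partial>lborel) \<le> 1" .
qed

text \<open>Hoelder's inequality with the sharp constant 1, by integrating Young's inequality for
  the normalised averages of h and f. The kernel \<open>k\<close> is the usual norming function of
  \<open>avg f\<close> in \<open>L\<^sub>p\<close>.\<close>

lemma norming_kernel_bound:
  assumes f: "borel_rep f" and N: "0 < ces_norm f" and h: "borel_rep h"
  defines "k \<equiv> \<lambda>x. (avg f x / ces_norm f) powr (p - 1)"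
  shows "(\<integral>\<^sup>+x. ennreal (indicator J x * (k x * avg h x)) \<partial>lborel) \<le> ennreal (1 * ces_norm h)"
proof (rule ennreal_le_epsilon)
  fix e :: real assume e: "0 < e"
  \<comment> \<open>The norm of h may be 0, so it is enlarged before dividing by it.\<close>
  define H where "H = ces_norm h + e"
  have H: "ces_norm h \<le> H" "0 < H"
    using e ces_norm_nonneg[of h] by (auto simp: H_def)
  note a = avg_powr_integral_le[OF h H] and b = avg_powr_integral_le[OF f order_refl N]
  let ?r = "\<lambda>x. H / p * (indicator J x * (avg h x / H) powr p + (p - 1) * (indicator J x * (avg f x / ces_norm f) powr p))"
  have "indicator J x * (k x * avg h x) \<le> ?r x" for x
  proof (cases "x \<in> J")
    case True
    have "p * (k x * (avg h x / H)) \<le> (avg h x / H) powr p + (p - 1) * (avg f x / ces_norm f) powr p"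
      unfolding k_def using J_pos[OF True] H N p by (intro young_powr divide_nonneg_pos avg_nonneg) auto
    then have "H / p * (p * (k x * (avg h x / H))) \<le> H / p * ((avg h x / H) powr p + (p - 1) * (avg f x / ces_norm f) powr p)"
      using H p by (intro mult_left_mono) auto
    moreover have "H / p * (p * (k x * (avg h x / H))) = k x * avg h x"
      using H p by simp
    ultimately show ?thesis
      using True by simp
  qed simp
  then have "(\<integral>\<^sup>+x. ennreal (indicator J x * (k x * avg h x)) \<partial>lborel) \<le> (\<integral>\<^sup>+x. ennreal (?r x) \<partial>lborel)"
    by (intro nn_integral_mono ennreal_leI)
  also have "\<dots> = ennreal (\<integral>x. ?r x \<partial>lborel)"
    using H p a(2) b(2)
    by (intro nn_integral_eq_integral integrable_mult_right Bochner_Integration.integrable_add AE_I2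
        mult_nonneg_nonneg add_nonneg_nonneg) auto
  finally have le: "(\<integral>\<^sup>+x. ennreal (indicator J x * (k x * avg h x)) \<partial>lborel) \<le> ennreal (\<integral>x. ?r x \<partial>lborel)" .
  have "(\<integral>x. ?r x \<partial>lborel) = H / p * ((\<integral>x. indicator J x * (avg h x / H) powr p \<partial>lborel)
      + (p - 1) * (\<integral>x. indicator J x * (avg f x / ces_norm f) powr p \<partial>lborel))"
    using a(2) b(2) by simp
  also have "\<dots> \<le> H / p * (1 + (p - 1) * 1)"
    using H p by (intro mult_left_mono add_mono a(1) b(1)) auto
  finally have "(\<integral>x. ?r x \<partial>lborel) \<le> H / p * (1 + (p - 1) * 1)" .
  then have leH: "ennreal (\<integral>x. ?r x \<partial>lborel) \<le> ennreal H"
    using p by (intro ennreal_leI) simp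
  note le
  also note leH
  also have "ennreal H = ennreal (1 * ces_norm h) + ennreal e"
    using e ces_norm_nonneg[of h] by (simp add: H_def)
  finally show "(\<integral>\<^sup>+x. ennreal (indicator J x * (k x * avg h x)) \<partial>lborel) \<le> ennreal (1 * ces_norm h) + ennreal e" .
qed

text \<open>Transposing the averaging operator turns \<open>k\<close> into a weight with which |f|
  has the same integral as \<open>k\<close> has with \<open>avg f\<close>, namely norm^p / norm^(p -
  1). The sign of f then converts |f| into f.\<close>

lemma norming_functional:
  assumes u: "u \<in> ns_carrier (Ces p I)"
  shows "\<exists>\<psi>\<in>ns_dual (Ces p I). \<psi> u = ns_norm (Ces p I) u \<and>
    (\<forall>v\<in>ns_carrier (Ces p I). \<bar>\<psi> v\<bar> \<le> ns_norm (Ces p I) v)"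
proof -
  obtain f where f: "borel_rep f" "u = cls f"
    using borel_rep_representative[OF u] .
  have [measurable]: "f \<in> borel_measurable borel"
    using f(1) by (rule borel_rep_measurable)
  show ?thesis
  proof (cases "0 < ces_norm f")
    case False
    then have "ces_norm f = 0"
      using ces_norm_nonneg[of f] by simp
    moreover have "(\<lambda>v. 0) \<in> ns_dual (Ces p I)"
      by (auto simp: ns_dual_def intro!: exI[of _ 0])
    moreover have "0 \<le> ns_norm (Ces p I) v" if "v \<in> ns_carrier (Ces p I)" for v
      using borel_rep_representative[OF that] ces_norm_nonneg by (metis ns_norm_cls)
    ultimately show ?thesis
      using f by (intro bexI[of _ "\<lambda>v. 0"]) (auto simp: ns_norm_cls)
  next
    case N: True
    define k where "k = (\<lambda>x. (avg f x / ces_norm f) powr (p - 1))"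
    have [measurable]: "k \<in> borel_measurable borel"
      unfolding k_def by measurable
    have start: "0 \<le> k x" for x
      by (simp add: k_def)
    have b: "(\<integral>\<^sup>+x. ennreal (indicator J x * (k x * avg h x)) \<partial>lborel) \<le> ennreal (1 * ces_norm h)" if "borel_rep h" for h
      unfolding k_def by (rule norming_kernel_bound[OF f(1) N that])
    let ?v = "\<lambda>t. enn2real (weight k t)"
    have W: "(\<integral>\<^sup>+t. ennreal (\<bar>h t\<bar> * ?v t) \<partial>lborel) = (\<integral>\<^sup>+x. ennreal (indicator J x * (k x * avg h x)) \<partial>lborel)"
      "integrable lborel (\<lambda>t. \<bar>h t\<bar> * ?v t)" "(\<integral>t. \<bar>h t\<bar> * ?v t \<partial>lborel) \<le> 1 * ces_norm h" if "borel_rep h" for h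
      using weight_functional[OF \<open>k \<in> borel_measurable borel\<close> start b zero_le_one that] by simp_all
    let ?s = "\<lambda>t. sgn (f t)"
    have vm: "?v \<in> borel_measurable borel" and sm: "?s \<in> borel_measurable borel"
      by measurable
    have s1: "\<bar>?s t\<bar> \<le> 1" for t
      by (simp add: sgn_real_def)
    note D = dominated_dual[OF sm vm s1 enn2real_nonneg W(2,3), simplified]
    let ?g = "\<lambda>t. ?s t * ?v t"
    have gm: "?g \<in> borel_measurable borel"
      by measurable
    have "pairing ?g u = (\<integral>t. f t * ?g t \<partial>lborel)"
      unfolding f(2) by (rule pairing_cls[OF f(1) gm])
    also have "\<dots> = (\<integral>t. \<bar>f t\<bar> * ?v t \<partial>lborel)"
      by (intro Bochner_Integration.integral_cong) (auto simp: sgn_real_def)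
    also have "\<dots> = ces_norm f"
    proof -
      have "ennreal (\<integral>t. \<bar>f t\<bar> * ?v t \<partial>lborel) = (\<integral>\<^sup>+t. ennreal (\<bar>f t\<bar> * ?v t) \<partial>lborel)"
        using W(2)[OF f(1)] by (intro nn_integral_eq_integral[symmetric]) auto
      also have "\<dots> = (\<integral>\<^sup>+x. ennreal (indicator J x * (k x * avg f x)) \<partial>lborel)"
        using W(1)[OF f(1)] by simp
      also have "\<dots> = (\<integral>\<^sup>+x. ennreal (ces_norm f * (indicator J x * avg f x powr p / ces_norm f powr p)) \<partial>lborel)"
      proof (intro nn_integral_cong arg_cong[where f=ennreal])
        fix x
        show "indicator J x * (k x * avg f x) = ces_norm f * (indicator J x * avg f x powr p / ces_norm f powr p)"
        \<comment> \<open>Since \<open>powr\<close> is 0 at base 0 for every exponent, including 0,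
          both sides vanish where \<open>avg f\<close> does, also for p = 1.\<close>
        proof (cases "x \<in> J \<and> avg f x \<noteq> 0")
          case True
          then have "0 < avg f x"
            using avg_nonneg[of x f] J_pos[of x] by auto
          then show ?thesis
            using True N by (simp add: k_def powr_divide powr_diff field_simps)
        qed auto
      qed
      also have "\<dots> = ennreal (\<integral>x. ces_norm f * (indicator J x * avg f x powr p / ces_norm f powr p) \<partial>lborel)"
        using borel_rep_avg_integrable[OF f(1)] N by (intro nn_integral_eq_integral) auto
      also have "(\<integral>x. ces_norm f * (indicator J x * avg f x powr p / ces_norm f powr p) \<partial>lborel) = ces_norm f"
        using N by (simp flip: ces_norm_powr)
      finally show ?thesis
        using N by (simp add: Bochner_Integration.integral_nonneg)
    qed
    finally have "pairing ?g u = ns_norm (Ces p I) u"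
      using f by (simp add: ns_norm_cls)
    moreover have "\<bar>pairing ?g v\<bar> \<le> ns_norm (Ces p I) v" if v: "v \<in> ns_carrier (Ces p I)" for v
    proof -
      obtain h where h: "borel_rep h" "v = cls h"
        using borel_rep_representative[OF v] .
      show ?thesis
        using D(2)[OF h(1)] h by (simp add: pairing_cls[OF h(1) gm] ns_norm_cls)
    qed
    ultimately show ?thesis
      using D(1) by blast
  qed
qed

section \<open>The Banach-Saks property\<close>

text \<open>Multiplication by an admissible weight maps \<open>Ces p I\<close> boundedly into \<open>L\<^sub>1\<close> of a set of finite measure.\<close>

definition admissible :: "(real \<Rightarrow> real) \<Rightarrow> bool" where
  "admissible v \<longleftrightarrow> v \<in> borel_measurable borel \<and> (\<forall>x. 0 \<le> v x) \<and>
     (\<exists>C\<ge>0. \<forall>g. borel_rep g \<longrightarrow> integrable lborel (\<lambda>x. \<bar>g x\<bar> * v x) \<and> (\<integral>x. \<bar>g x\<bar> * v x \<partial>lborel) \<le> C * ces_norm g) \<and>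
     (\<exists>E\<in>sets lborel. emeasure lborel E < \<infinity> \<and> (\<forall>x. x \<notin> E \<longrightarrow> v x = 0))"

text \<open>The level K is picked only after the subsequence, according to the accuracy wanted.
  Imposing the bound for all K up to the length of the history makes each level available from some
  stage on. The bound 1 can be any constant, as it is divided by K in the end.\<close>

definition almost_orthogonal :: "(real \<Rightarrow> real) \<Rightarrow> (nat \<Rightarrow> real \<Rightarrow> real) \<Rightarrow> nat list \<Rightarrow> nat \<Rightarrow> bool" where
  "almost_orthogonal v f xs n \<longleftrightarrow> (\<forall>K\<le>length xs.
     \<bar>\<integral>x. clamp_real (real K) (\<Sum>i<length xs. f (xs ! i) x * v x) * (f n x * v x) \<partial>lborel\<bar> \<le> 1)"

lemma admissible_indicator:
  assumes b: "b \<in> J"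
  shows "admissible (indicator {0..b})"
proof -
  obtain C where C: "0 \<le> C" "\<And>f. borel_rep f \<Longrightarrow> cumulative f b \<le> C * ces_norm f"
    using cumulative_bound[OF b] by blast
  have "integrable lborel (\<lambda>x. \<bar>g x\<bar> * indicator {0..b} x) \<and> (\<integral>x. \<bar>g x\<bar> * indicator {0..b} x \<partial>lborel) \<le> C * ces_norm g"
    if "borel_rep g" for g
    using borel_rep_integrable_abs[OF that b] C(2)[OF that] by (simp add: cumulative_def mult.commute)
  moreover have "\<exists>E\<in>sets lborel. emeasure lborel E < \<infinity> \<and> (\<forall>x. x \<notin> E \<longrightarrow> indicator {0..b} x = (0::real))"
    by (intro bexI[of _ "{0..b}"]) (auto simp: emeasure_lborel_Icc_eq)
  ultimately show ?thesis
    unfolding admissible_def using C(1) by auto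
qed

section \<open>Weakly null sequences under an admissible weight\<close>

context
  fixes f :: "nat \<Rightarrow> real \<Rightarrow> real" and v :: "real \<Rightarrow> real" and M :: real
  assumes f: "\<And>n. borel_rep (f n)"
    and wn: "weakly_null (Ces p I) (\<lambda>n. cls (f n))"
    and M: "\<And>n. ces_norm (f n) \<le> M"
    and v: "admissible v"
begin

lemma v_measurable: "v \<in> borel_measurable borel" and v_nonneg: "0 \<le> v x"
  using v by (auto simp: admissible_def)

lemma weighted_integrable: "integrable lborel (\<lambda>x. f n x * v x)"
proof -
  have [measurable]: "f n \<in> borel_measurable borel" "v \<in> borel_measurable borel"
    using borel_rep_measurable[OF f] v_measurable by auto
  have "integrable lborel (\<lambda>x. \<bar>f n x\<bar> * v x)"
    using v f by (auto simp: admissible_def)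
  then show ?thesis
    by (rule Bochner_Integration.integrable_bound) (auto simp: abs_mult)
qed

lemma weighted_bounded:
  obtains B where "\<And>n. (\<integral>x. \<bar>f n x * v x\<bar> \<partial>lborel) \<le> B"
proof -
  obtain C where C: "C \<ge> 0" "\<And>g. borel_rep g \<Longrightarrow> (\<integral>x. \<bar>g x\<bar> * v x \<partial>lborel) \<le> C * ces_norm g"
    using v by (auto simp: admissible_def)
  have "(\<integral>x. \<bar>f n x * v x\<bar> \<partial>lborel) \<le> C * M" for n
    using C(2)[OF f, of n] mult_left_mono[OF M[of n] C(1)] v_nonneg by (simp add: abs_mult)
  then show ?thesis
    by (rule that)
qed

lemma weighted_null:
  assumes [measurable]: "s \<in> borel_measurable borel" and s: "\<And>x. \<bar>s x\<bar> \<le> c"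
  shows "(\<lambda>n. \<integral>x. s x * (f n x * v x) \<partial>lborel) \<longlonglongrightarrow> 0"
proof -
  obtain C where C: "\<And>g. borel_rep g \<Longrightarrow> integrable lborel (\<lambda>x. \<bar>g x\<bar> * v x)"
      "\<And>g. borel_rep g \<Longrightarrow> (\<integral>x. \<bar>g x\<bar> * v x \<partial>lborel) \<le> C * ces_norm g"
    using v by (auto simp: admissible_def)
  have "pairing (\<lambda>x. s x * v x) \<in> ns_dual (Ces p I)"
    by (rule dominated_dual(1)[OF assms(1) v_measurable s v_nonneg C])
  then have "(\<lambda>n. pairing (\<lambda>x. s x * v x) (cls (f n))) \<longlonglongrightarrow> 0"
    using wn by (auto simp: weakly_null_def)
  moreover have "pairing (\<lambda>x. s x * v x) (cls (f n)) = (\<integral>x. s x * (f n x * v x) \<partial>lborel)" for n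
    using v_measurable by (subst pairing_cls[OF f]) (auto simp: mult_ac)
  ultimately show ?thesis
    by simp
qed

lemma weighted_equi_continuous:
  assumes "0 < e"
  obtains d where "0 < d"
    "\<And>n A. A \<in> sets lborel \<Longrightarrow> emeasure lborel A < ennreal d \<Longrightarrow>
      (\<integral>x. indicator A x * \<bar>f n x * v x\<bar> \<partial>lborel) \<le> e"
proof (rule integral_null_imp_equi_continuous[OF weighted_integrable _ assms])
  fix A :: "real set" assume "A \<in> sets lborel"
  then show "(\<lambda>n. \<integral>x. indicator A x * (f n x * v x) \<partial>lborel) \<longlonglongrightarrow> 0"
    by (intro weighted_null[where c=1]) (auto simp: indicator_def)
qed (use that in blast)

text \<open>With the history fixed, every clamped sum is one fixed bounded test function, and only
  finitely many levels occur.\<close>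

lemma eventually_almost_orthogonal: "eventually (almost_orthogonal v f xs) sequentially"
proof -
  have [measurable]: "f n \<in> borel_measurable borel" "v \<in> borel_measurable borel" for n
    using borel_rep_measurable[OF f] v_measurable by auto
  let ?h = "\<lambda>K x. clamp_real (real K) (\<Sum>i<length xs. f (xs ! i) x * v x)"
  have "\<forall>\<^sub>F n in sequentially. \<bar>\<integral>x. ?h K x * (f n x * v x) \<partial>lborel\<bar> \<le> 1" for K
  proof -
    have "(\<lambda>n. \<integral>x. ?h K x * (f n x * v x) \<partial>lborel) \<longlonglongrightarrow> 0"
    proof (rule weighted_null[where c="real K"])
      show "?h K \<in> borel_measurable borel"
        by measurable
    qed (rule abs_clamp_real_le, simp)
    then have "\<forall>\<^sub>F n in sequentially. dist (\<integral>x. ?h K x * (f n x * v x) \<partial>lborel) 0 < 1"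
      by (rule tendstoD) simp
    then show ?thesis
      by eventually_elim simp
  qed
  then have "\<forall>\<^sub>F n in sequentially. \<forall>K\<in>{..length xs}. \<bar>\<integral>x. ?h K x * (f n x * v x) \<partial>lborel\<bar> \<le> 1"
    by (intro eventually_ball_finite) auto
  then show ?thesis
    by eventually_elim (auto simp: almost_orthogonal_def)
qed

text \<open>The parameter \<open>start\<close> lets a single subsequence serve countably many
  weights, the j-th of them being controlled only from stage j on.\<close>

lemma weighted_means_tendsto_0:
  assumes almost_orthogonal: "\<And>k. start \<le> k \<Longrightarrow> almost_orthogonal v f (map r [0..<k]) (r k)"
  shows "(\<lambda>m. (\<integral>x. \<bar>\<Sum>k<m. f (r k) x\<bar> * v x \<partial>lborel) / real m) \<longlonglongrightarrow> 0"
proof -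
  obtain E where E: "E \<in> sets lborel" "emeasure lborel E < \<infinity>" "\<And>x. x \<notin> E \<Longrightarrow> v x = 0"
    using v by (auto simp: admissible_def)
  obtain B where B: "\<And>n. (\<integral>x. \<bar>f n x * v x\<bar> \<partial>lborel) \<le> B"
    using weighted_bounded by blast
  have "(\<lambda>m. (\<integral>x. \<bar>\<Sum>k<m. f (r k) x * v x\<bar> \<partial>lborel) / real m) \<longlonglongrightarrow> 0"
  proof (rule L1_means_tendsto_0[where f="\<lambda>n x. f n x * v x" and E=E and B=B])
    fix e :: real assume e: "0 < e"
    obtain d where d: "0 < d" "\<And>n A. A \<in> sets lborel \<Longrightarrow> emeasure lborel A < ennreal d \<Longrightarrow>
        (\<integral>x. indicator A x * \<bar>f n x * v x\<bar> \<partial>lborel) \<le> e"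
      using weighted_equi_continuous[OF e] by blast
    show "\<exists>L\<ge>0. \<forall>n. (\<integral>x. indicator {x. L < \<bar>f n x * v x\<bar>} x * \<bar>f n x * v x\<bar> \<partial>lborel) \<le> e"
      by (rule equi_continuous_imp_uniformly_integrable[OF weighted_integrable B d])
  next
    fix k K assume "start \<le> k" "K \<le> k"
    then show "\<bar>\<integral>x. clamp_real (real K) (\<Sum>i<k. f (r i) x * v x) * (f (r k) x * v x) \<partial>lborel\<bar> \<le> 1"
      using almost_orthogonal[of k] by (simp add: almost_orthogonal_def)
  qed (use weighted_integrable E B in auto)
  moreover have "\<bar>\<Sum>k<m. f (r k) x * v x\<bar> = \<bar>\<Sum>k<m. f (r k) x\<bar> * v x" for m x
    using v_nonneg[of x] by (simp add: abs_mult flip: sum_distrib_right)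
  ultimately show ?thesis
    by simp
qed

end

text \<open>A Helly-type selection: a diagonal subsequence converges at rational points, and
  equi-integrability makes the monotone functions \<open>cumulative (f n)\<close> equicontinuous
  from the left, so convergence spreads to every point of \<open>J\<close>.\<close>

lemma cumulative_convergent_subsequence:
  assumes f: "\<And>n. borel_rep (f n)"
    and wn: "weakly_null (Ces p I) (\<lambda>n. cls (f n))"
    and M: "\<And>n. ces_norm (f n) \<le> M"
  obtains s where "strict_mono s" "\<And>x. x \<in> J \<Longrightarrow> convergent (\<lambda>n. cumulative (f (s n)) x)"
proof -
  define u where "u n q = (if of_rat q \<in> J then cumulative (f n) (of_rat q) else 0)" for n and q :: rat
  have "\<exists>c. \<forall>n. \<bar>u n q\<bar> \<le> c" for q
  proof (cases "real_of_rat q \<in> J")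
    case True
    obtain C where C: "0 \<le> C" "\<And>f. borel_rep f \<Longrightarrow> cumulative f (of_rat q) \<le> C * ces_norm f"
      using cumulative_bound[OF True] by blast
    have "\<bar>u n q\<bar> \<le> C * M" for n
      using C(2)[OF f, of n] mult_left_mono[OF M[of n] C(1)] True cumulative_nonneg[of "f n" "of_rat q"]
      by (simp add: u_def)
    then show ?thesis
      by blast
  qed (auto simp: u_def)
  then obtain c where "\<And>n q. \<bar>u n q\<bar> \<le> c q"
    by metis
  from pointwise_bounded_subsequence[of u, OF this] obtain s
    where s: "strict_mono s" "\<And>q. convergent (\<lambda>n. u (s n) q)"
    by blast
  have "convergent (\<lambda>n. cumulative (f (s n)) x)" if x: "x \<in> J" for x
  proof (rule Cauchy_convergent, rule metric_CauchyI)
    fix e :: real assume "0 < e"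
    then have e3: "0 < e / 4" by simp
    obtain d where d: "0 < d" "\<And>n A. A \<in> sets lborel \<Longrightarrow> emeasure lborel A < ennreal d \<Longrightarrow>
        (\<integral>t. indicator A t * \<bar>f n t * indicator {0..x} t\<bar> \<partial>lborel) \<le> e / 4"
      using weighted_equi_continuous[OF f wn M admissible_indicator[OF x] e3] by blast
    \<comment> \<open>The maximum with 0 keeps the rational point positive, hence in
      \<open>J\<close>.\<close>
    have "max 0 (x - d) < x"
      using J_pos[OF x] d(1) by simp
    from of_rat_dense[OF this] obtain q where q: "max 0 (x - d) < of_rat q" "of_rat q < x"
      by blast
    then have qJ: "of_rat q \<in> J"
      using J_downward[OF x, of "of_rat q"] by simp
    have close: "\<bar>cumulative (f n) x - cumulative (f n) (of_rat q)\<bar> \<le> e / 4" for n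
    proof -
      have "cumulative (f n) x - cumulative (f n) (of_rat q) =
          (\<integral>t. indicator {0..x} t * \<bar>f n t\<bar> - indicator {0..of_rat q} t * \<bar>f n t\<bar> \<partial>lborel)"
        unfolding cumulative_def
        by (intro Bochner_Integration.integral_diff[symmetric] borel_rep_integrable_abs f x qJ)
      also have "\<dots> = (\<integral>t. indicator {of_rat q<..x} t * \<bar>f n t * indicator {0..x} t\<bar> \<partial>lborel)"
        using q by (intro Bochner_Integration.integral_cong) (auto simp: indicator_def)
      also have "\<dots> \<le> e / 4"
      proof (rule d(2))
        show "emeasure lborel {of_rat q<..x} < ennreal d"
          using q d(1) by (auto intro!: ennreal_lessI)
      qed simp
      finally have "cumulative (f n) x - cumulative (f n) (of_rat q) \<le> e / 4" .
      moreover have "cumulative (f n) (of_rat q) \<le> cumulative (f n) x"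
        using q by (intro cumulative_mono f x) simp
      ultimately show ?thesis
        by simp
    qed
    have "Cauchy (\<lambda>n. u (s n) q)"
      using s(2) by (rule convergent_Cauchy)
    from metric_CauchyD[OF this e3] obtain N
      where N: "\<And>m n. N \<le> m \<Longrightarrow> N \<le> n \<Longrightarrow> dist (u (s m) q) (u (s n) q) < e / 4"
      by blast
    show "\<exists>N. \<forall>m\<ge>N. \<forall>n\<ge>N. dist (cumulative (f (s m)) x) (cumulative (f (s n)) x) < e"
    proof (intro exI[of _ N] allI impI)
      fix m n assume "N \<le> m" "N \<le> n"
      then show "dist (cumulative (f (s m)) x) (cumulative (f (s n)) x) < e"
        using N[of m n] close[of "s m"] close[of "s n"] qJ \<open>0 < e\<close>
        unfolding dist_real_def u_def if_P[OF qJ] by linarith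
    qed
  qed
  with s(1) that show ?thesis
    by blast
qed

section \<open>The case p > 1\<close>

lemma J_exhaustion:
  obtains b :: "nat \<Rightarrow> real" where "\<And>j. b j \<in> J" "\<And>x. x \<in> J \<Longrightarrow> \<exists>j. x \<le> b j"
  using IJ
proof
  assume *: "I = {0..1} \<and> J = {0<..<1}"
  show ?thesis
  proof
    show "1 - 1 / (real j + 2) \<in> J" for j
      using * by (auto simp: field_simps)
    show "\<exists>j. x \<le> 1 - 1 / (real j + 2)" if "x \<in> J" for x
    proof -
      have x: "0 < 1 - x"
        using that * by auto
      obtain j :: nat where "1 / (1 - x) < real j"
        using reals_Archimedean2 by blast
      then have "1 / (real j + 2) \<le> 1 - x"
        using x by (simp add: field_simps)
      then show ?thesis
        by (intro exI[of _ j]) simp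
    qed
  qed
next
  assume *: "I = {0..} \<and> J = {0<..}"
  show ?thesis
  proof
    show "real j + 1 \<in> J" for j
      using * by auto
    show "\<exists>j. x \<le> real j + 1" for x
    proof -
      obtain j :: nat where "x \<le> real j"
        using real_arch_simple by blast
      then show ?thesis
        by (intro exI[of _ j]) simp
    qed
  qed
qed

lemma cumulative_sum_le:
  fixes m :: nat
  assumes "\<And>k. borel_rep (f k)" "x \<in> J"
  shows "cumulative (\<lambda>t. \<Sum>k<m. f k t) x \<le> (\<Sum>k<m. cumulative (f k) x)"
proof -
  have "cumulative (\<lambda>t. \<Sum>k<m. f k t) x \<le> (\<integral>t. (\<Sum>k<m. indicator {0..x} t * \<bar>f k t\<bar>) \<partial>lborel)"
    unfolding cumulative_def
  proof (intro integral_mono borel_rep_integrable_abs borel_rep_sum assms Bochner_Integration.integrable_sum)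
    fix t
    show "indicator {0..x} t * \<bar>\<Sum>k<m. f k t\<bar> \<le> (\<Sum>k<m. indicator {0..x} t * \<bar>f k t\<bar>)"
      using sum_abs[of "\<lambda>k. f k t" "{..<m}"] by (auto simp: indicator_def)
  qed
  also have "\<dots> = (\<Sum>k<m. cumulative (f k) x)"
    unfolding cumulative_def by (intro Bochner_Integration.integral_sum borel_rep_integrable_abs assms)
  finally show ?thesis .
qed

lemma banach_saks_gt_1:
  assumes p1: "1 < p"
    and f: "\<And>n. borel_rep (f n)"
    and wn: "weakly_null (Ces p I) (\<lambda>n. cls (f n))"
    and M: "\<And>n. ces_norm (f n) \<le> M"
    and conv: "\<And>x. x \<in> J \<Longrightarrow> convergent (\<lambda>n. cumulative (f n) x)"
  obtains r where "strict_mono r" "(\<lambda>m. 1 / real m * ces_norm (\<lambda>x. \<Sum>k<m. f (r k) x)) \<longlonglongrightarrow> 0"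
proof -
  have f_meas[measurable]: "f n \<in> borel_measurable borel" for n
    using f by (rule borel_rep_measurable)
  have p0: "0 < p"
    using p1 by simp
  obtain b where b: "\<And>j::nat. b j \<in> J" "\<And>x. x \<in> J \<Longrightarrow> \<exists>j. x \<le> b j"
    using J_exhaustion by blast
  \<comment> \<open>Off \<open>J\<close> the factor makes the sequence constantly 0, so the limit
    exists at every point and \<open>A\<close> is Borel on the whole line.\<close>
  define A where "A x = lim (\<lambda>n. indicator J x * avg (f n) x)" for x
  have [measurable]: "A \<in> borel_measurable borel"
    unfolding A_def[abs_def] by (intro borel_measurable_lim_metric) measurable
  have A_lim: "(\<lambda>n. indicator J x * avg (f n) x) \<longlonglongrightarrow> A x" for x
  proof -
    have "convergent (\<lambda>n. indicator J x * avg (f n) x)"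
    proof (cases "x \<in> J")
      case True
      then have "convergent (\<lambda>n. cumulative (f n) x * (1 / x))"
        using conv by (intro convergent_mult convergent_const)
      then show ?thesis
        using True by (simp add: avg_def)
    qed (simp add: convergent_const)
    then show ?thesis
      unfolding A_def by (simp add: convergent_LIMSEQ_iff)
  qed
  have avgJ_nonneg: "0 \<le> indicator J x * avg h x" for x h
    using J_pos[of x] avg_nonneg[of x h] by (cases "x \<in> J") auto
  have A0: "0 \<le> A x" for x
    by (rule LIMSEQ_le_const[OF A_lim]) (use avgJ_nonneg in blast)
  have avgJ_powr: "(indicator J x * avg h x) powr p = indicator J x * avg h x powr p" for x h
    by (cases "x \<in> J") auto
  have M_powr: "(\<integral>x. indicator J x * avg (f n) x powr p \<partial>lborel) \<le> M powr p" for n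
    unfolding ces_norm_powr[symmetric] using M ces_norm_nonneg p0 by (intro powr_mono2) auto
  have A_int: "integrable lborel (\<lambda>x. A x powr p)"
  \<comment> \<open>Fatou's lemma: the p-th powers of the averages have integrals bounded by
    M^p.\<close>
  proof (rule integrableI_nonneg)
    have "(\<integral>\<^sup>+x. ennreal (A x powr p) \<partial>lborel) = (\<integral>\<^sup>+x. liminf (\<lambda>n. ennreal (indicator J x * avg (f n) x powr p)) \<partial>lborel)"
    proof (intro nn_integral_cong)
      fix x
      have "(\<lambda>n. (indicator J x * avg (f n) x) powr p) \<longlonglongrightarrow> A x powr p"
        by (rule tendsto_powr'[OF A_lim tendsto_const]) (use p0 avgJ_nonneg in auto)
      then have "(\<lambda>n. ennreal (indicator J x * avg (f n) x powr p)) \<longlonglongrightarrow> ennreal (A x powr p)"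
        by (intro tendsto_ennrealI) (simp add: avgJ_powr)
      then show "ennreal (A x powr p) = liminf (\<lambda>n. ennreal (indicator J x * avg (f n) x powr p))"
        by (intro lim_imp_Liminf[symmetric]) auto
    qed
    also have "\<dots> \<le> liminf (\<lambda>n. \<integral>\<^sup>+x. ennreal (indicator J x * avg (f n) x powr p) \<partial>lborel)"
      by (intro nn_integral_liminf) measurable
    also have "\<dots> \<le> liminf (\<lambda>n. ennreal (M powr p))"
    proof (intro Liminf_mono always_eventually allI)
      fix n
      show "(\<integral>\<^sup>+x. ennreal (indicator J x * avg (f n) x powr p) \<partial>lborel) \<le> ennreal (M powr p)"
        using M_powr[of n] by (subst nn_integral_eq_integral[OF borel_rep_avg_integrable[OF f]]) (auto intro: ennreal_leI)
    qed
    also have "\<dots> = ennreal (M powr p)"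
      by (simp add: Liminf_const)
    also have "\<dots> < \<infinity>"
      by simp
    finally show "(\<integral>\<^sup>+x. ennreal (A x powr p) \<partial>lborel) < \<infinity>" .
  qed auto
  \<comment> \<open>Only upper bounds for the averages are used later, so the positive part
    suffices; since A \<ge> 0, it is dominated by the average and inherits its
    \<open>L\<^sub>p\<close> bound.\<close>
  define D where "D n x = max 0 (indicator J x * avg (f n) x - A x)" for n x
  have [measurable]: "D n \<in> borel_measurable borel" for n
    unfolding D_def[abs_def] by measurable
  have D0: "0 \<le> D n x" for n x
    by (simp add: D_def)
  have D_lim: "(\<lambda>n. D n x) \<longlonglongrightarrow> 0" for x
  proof -
    have "(\<lambda>n. D n x) \<longlonglongrightarrow> max 0 (A x - A x)"
      unfolding D_def by (intro tendsto_intros A_lim)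
    then show ?thesis by simp
  qed
  have D_le: "D n x powr p \<le> indicator J x * avg (f n) x powr p" for n x
  proof -
    have "D n x powr p \<le> (indicator J x * avg (f n) x) powr p"
      using A0[of x] avgJ_nonneg[of x "f n"] p0 by (intro powr_mono2) (auto simp: D_def)
    then show ?thesis
      by (simp add: avgJ_powr)
  qed
  have D_int: "integrable lborel (\<lambda>x. D n x powr p)" for n
    by (rule Bochner_Integration.integrable_bound[OF borel_rep_avg_integrable[OF f[of n]]])
      (use D_le in auto)
  have D_bound: "(\<integral>x. D n x powr p \<partial>lborel) \<le> M powr p" for n
    using integral_mono[OF D_int borel_rep_avg_integrable[OF f] D_le, of n] M_powr[of n] by simp
  \<comment> \<open>Finitely many conditions per stage: the interval \<open>[0, b j]\<close> is
    taken into account from stage j on, and the interaction of the next excess with the sum of the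
    earlier ones is at most 1.\<close>
  define Q where "Q xs n \<longleftrightarrow> (\<forall>j\<in>{..length xs}. almost_orthogonal (indicator {0..b j}) f xs n) \<and>
      (\<integral>x. ((\<Sum>i<length xs. D (xs ! i) x) + min (\<Sum>i<length xs. D (xs ! i) x) (D n x)) powr p
        - (\<Sum>i<length xs. D (xs ! i) x) powr p \<partial>lborel) \<le> 1" for xs n
  have "\<exists>\<^sub>F n in sequentially. Q xs n" for xs
  proof (intro eventually_frequently)
    let ?S = "\<lambda>x. \<Sum>i<length xs. D (xs ! i) x"
    have "\<forall>\<^sub>F n in sequentially. \<forall>j\<in>{..length xs}. almost_orthogonal (indicator {0..b j}) f xs n"
      by (intro eventually_ball_finite ballI eventually_almost_orthogonal[OF f wn M] admissible_indicator b) auto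
    moreover have "(\<lambda>n. \<integral>x. (?S x + min (?S x) (D n x)) powr p - ?S x powr p \<partial>lborel) \<longlonglongrightarrow> 0"
    proof (rule integral_powr_add_min_tendsto)
      show "integrable lborel (\<lambda>x. ?S x powr p)"
        using p0 by (intro integrable_powr_sum D0 D_int) auto
    qed (use D_lim D0 p0 in \<open>auto intro: sum_nonneg\<close>)
    then have "\<forall>\<^sub>F n in sequentially. dist (\<integral>x. (?S x + min (?S x) (D n x)) powr p - ?S x powr p \<partial>lborel) 0 < 1"
      by (rule tendstoD) simp
    ultimately show "\<forall>\<^sub>F n in sequentially. Q xs n"
      by eventually_elim (auto simp: Q_def dist_real_def)
  qed simp
  from strict_mono_selection[of Q, OF this] obtain r where r: "strict_mono r"
      and Q: "\<And>k. Q (map r [0..<k]) (r k)"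
    by blast
  have almost_orthogonal: "almost_orthogonal (indicator {0..b j}) f (map r [0..<k]) (r k)" if "j \<le> k" for j k
    using Q[of k] that by (simp add: Q_def)
  have step: "(\<integral>x. ((\<Sum>i<k. D (r i) x) + min (\<Sum>i<k. D (r i) x) (D (r k) x)) powr p
        - (\<Sum>i<k. D (r i) x) powr p \<partial>lborel) \<le> 1" for k
    using Q[of k] by (simp add: Q_def)
  note DS = integral_powr_sum_le[where D=D and M=lborel and r=r, OF _ D0 p0 D_int D_bound step]
  define C where "C = 2 powr p * M powr p + 1"
  define T where "T m x = (\<Sum>k<m. D (r k) x) / real m" for m x
  have [measurable]: "T m \<in> borel_measurable borel" for m
    unfolding T_def[abs_def] by measurable
  have T0: "0 \<le> T m x" for m x
    by (simp add: T_def sum_nonneg D0)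
  have T_powr: "T m x powr p = (\<Sum>k<m. D (r k) x) powr p / real m powr p" for m x
    by (simp add: T_def powr_divide sum_nonneg D0)
  have T_int: "integrable lborel (\<lambda>x. T m x powr p)" for m
    unfolding T_powr using DS(1) by simp
  have T_le: "(\<integral>x. T m x powr p \<partial>lborel) \<le> real m * C / real m powr p" for m
    unfolding T_powr C_def using DS(2)[of m] by (simp add: divide_right_mono)
  define S where "S m x = (\<Sum>k<m. f (r k) x)" for m x
  have S: "borel_rep (S m)" for m
    unfolding S_def[abs_def] by (rule borel_rep_sum[OF f])
  have [measurable]: "S m \<in> borel_measurable borel" for m
    using S by (rule borel_rep_measurable)
  define a where "a m x = indicator J x * avg (S m) x / real m" for m x
  have [measurable]: "a m \<in> borel_measurable borel" for m
    unfolding a_def[abs_def] by measurable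
  have a0: "0 \<le> a m x" for m x
    by (simp add: a_def avgJ_nonneg)
  have a_powr: "a m x powr p = indicator J x * avg (S m) x powr p / real m powr p" for m x
    unfolding a_def avgJ_powr[symmetric] by (simp add: powr_divide avgJ_nonneg)
  have a_lim: "(\<lambda>m. a m x) \<longlonglongrightarrow> 0" for x
  proof (cases "x \<in> J")
    case True
    \<comment> \<open>The subsequence is controlled only on the countably many intervals
      \<open>[0, b j]\<close>; monotonicity of \<open>cumulative\<close> carries this over to
      x.\<close>
    obtain j where j: "x \<le> b j"
      using b(2)[OF True] by blast
    have "(\<lambda>m. (\<integral>x. \<bar>\<Sum>k<m. f (r k) x\<bar> * indicator {0..b j} x \<partial>lborel) / real m) \<longlonglongrightarrow> 0"
      using almost_orthogonal by (rule weighted_means_tendsto_0[OF f wn M admissible_indicator[OF b(1)]])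
    then have "(\<lambda>m. cumulative (S m) (b j) / real m * (1 / x)) \<longlonglongrightarrow> 0 * (1 / x)"
      by (intro tendsto_mult tendsto_const) (simp add: cumulative_def S_def mult.commute)
    then have lim: "(\<lambda>m. cumulative (S m) (b j) / real m * (1 / x)) \<longlonglongrightarrow> 0"
      by simp
    show ?thesis
    proof (rule tendsto_sandwich[OF _ _ tendsto_const lim])
      show "\<forall>\<^sub>F m in sequentially. a m x \<le> cumulative (S m) (b j) / real m * (1 / x)"
      proof (intro always_eventually allI)
        fix m
        have "cumulative (S m) x / (real m * x) \<le> cumulative (S m) (b j) / (real m * x)"
          using J_pos[OF True] by (intro divide_right_mono cumulative_mono S j b) auto
        then show "a m x \<le> cumulative (S m) (b j) / real m * (1 / x)"
          using True by (simp add: a_def avg_def mult.commute)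
      qed
    qed (simp add: a0)
  qed (simp add: a_def)
  have a_le: "a m x \<le> A x + T m x" for m x
  \<comment> \<open>For m = 0 the division by 0 makes \<open>a m x\<close> equal to 0.\<close>
  proof (cases "x \<in> J \<and> 0 < m")
    case True
    then have x: "x \<in> J" "0 < x" and m: "0 < real m"
      using J_pos by auto
    have "avg (S m) x \<le> (\<Sum>k<m. cumulative (f (r k)) x) / x"
      unfolding avg_def S_def[abs_def] using x by (intro divide_right_mono cumulative_sum_le f) auto
    also have "\<dots> = (\<Sum>k<m. indicator J x * avg (f (r k)) x)"
      using x by (simp add: avg_def sum_divide_distrib)
    also have "\<dots> \<le> (\<Sum>k<m. A x + D (r k) x)"
      by (intro sum_mono) (simp add: D_def)
    also have "\<dots> = real m * A x + (\<Sum>k<m. D (r k) x)"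
      by (simp add: sum.distrib)
    finally have "avg (S m) x / real m \<le> (real m * A x + (\<Sum>k<m. D (r k) x)) / real m"
      using m by (intro divide_right_mono) auto
    then show ?thesis
      using x m by (simp add: a_def T_def add_divide_distrib)
  next
    case False
    then have "a m x = 0"
      by (auto simp: a_def)
    then show ?thesis
      using A0[of x] T0[of m x] by simp
  qed
  \<comment> \<open>From a \<le> A + T follows a \<le> min a A + T. The first part has the majorant
    \<open>A\<close> for dominated convergence, and the second tends to 0 in
    \<open>L\<^sub>p\<close>.\<close>
  have min_int: "integrable lborel (\<lambda>x. min (a m x) (A x) powr p)" for m
    by (rule Bochner_Integration.integrable_bound[OF A_int])
      (use a0 A0 p0 in \<open>auto intro!: powr_mono2\<close>)
  have min_lim: "(\<lambda>m. \<integral>x. min (a m x) (A x) powr p \<partial>lborel) \<longlonglongrightarrow> 0"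
  proof -
    have "(\<lambda>m. \<integral>x. min (a m x) (A x) powr p \<partial>lborel) \<longlonglongrightarrow> (\<integral>x. 0 \<partial>(lborel :: real measure))"
    proof (rule integral_dominated_convergence[OF _ _ A_int])
      show "AE x in lborel. (\<lambda>m. min (a m x) (A x) powr p) \<longlonglongrightarrow> 0"
      proof (rule AE_I2)
        fix x
        have "(\<lambda>m. min (a m x) (A x)) \<longlonglongrightarrow> min 0 (A x)"
          by (intro tendsto_intros a_lim)
        then have "(\<lambda>m. min (a m x) (A x)) \<longlonglongrightarrow> 0"
          using A0[of x] by simp
        then have "(\<lambda>m. min (a m x) (A x) powr p) \<longlonglongrightarrow> 0 powr p"
          by (rule tendsto_powr'[OF _ tendsto_const]) (use p0 a0 A0 in auto)
        then show "(\<lambda>m. min (a m x) (A x) powr p) \<longlonglongrightarrow> 0"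
          by simp
      qed
      show "AE x in lborel. norm (min (a m x) (A x) powr p) \<le> A x powr p" for m
        using a0 A0 p0 by (auto intro!: powr_mono2)
    qed measurable
    then show ?thesis
      by simp
  qed
  have a_int_le: "(\<integral>x. a m x powr p \<partial>lborel) \<le> 2 powr p * ((\<integral>x. min (a m x) (A x) powr p \<partial>lborel) + real m * C / real m powr p)" for m
  proof -
    have "(\<integral>x. a m x powr p \<partial>lborel) \<le> (\<integral>x. 2 powr p * (min (a m x) (A x) powr p + T m x powr p) \<partial>lborel)"
    proof (rule integral_mono)
      show "integrable lborel (\<lambda>x. a m x powr p)"
        unfolding a_powr using borel_rep_avg_integrable[OF S] by simp
      show "integrable lborel (\<lambda>x. 2 powr p * (min (a m x) (A x) powr p + T m x powr p))"
        using min_int T_int by simp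
      fix x
      have "a m x powr p \<le> (min (a m x) (A x) + T m x) powr p"
        using a0[of m x] a_le[of m x] T0[of m x] p0 by (intro powr_mono2) auto
      also have "\<dots> \<le> 2 powr p * (min (a m x) (A x) powr p + T m x powr p)"
        using a0[of m x] A0[of x] T0[of m x] p0 by (intro powr_add_le) auto
      finally show "a m x powr p \<le> 2 powr p * (min (a m x) (A x) powr p + T m x powr p)" .
    qed
    also have "\<dots> = 2 powr p * ((\<integral>x. min (a m x) (A x) powr p \<partial>lborel) + (\<integral>x. T m x powr p \<partial>lborel))"
      using min_int T_int by simp
    also have "\<dots> \<le> 2 powr p * ((\<integral>x. min (a m x) (A x) powr p \<partial>lborel) + real m * C / real m powr p)"
      by (intro mult_left_mono add_left_mono T_le) simp
    finally show ?thesis .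
  qed
  have "(\<lambda>m. 2 powr p * ((\<integral>x. min (a m x) (A x) powr p \<partial>lborel) + real m * C / real m powr p)) \<longlonglongrightarrow> 2 powr p * (0 + 0)"
    by (intro tendsto_mult tendsto_add tendsto_const min_lim tendsto_powr_times_over p1)
  then have up: "(\<lambda>m. 2 powr p * ((\<integral>x. min (a m x) (A x) powr p \<partial>lborel) + real m * C / real m powr p)) \<longlonglongrightarrow> 0"
    by simp
  have int0: "0 \<le> (\<integral>x. a m x powr p \<partial>lborel)" for m
    by (rule Bochner_Integration.integral_nonneg) simp
  have "(\<lambda>m. \<integral>x. a m x powr p \<partial>lborel) \<longlonglongrightarrow> 0"
    by (rule tendsto_sandwich[OF _ _ tendsto_const up]) (auto simp: a_int_le int0)
  then have "(\<lambda>m. (\<integral>x. a m x powr p \<partial>lborel) powr (1 / p)) \<longlonglongrightarrow> 0 powr (1 / p)"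
    by (rule tendsto_powr'[OF _ tendsto_const]) (use p0 int0 in auto)
  moreover have "(\<integral>x. a m x powr p \<partial>lborel) powr (1 / p) = 1 / real m * ces_norm (S m)" for m
  proof -
    have "(\<integral>x. a m x powr p \<partial>lborel) = (ces_norm (S m) / real m) powr p"
      unfolding a_powr by (simp add: ces_norm_powr powr_divide ces_norm_nonneg)
    moreover have "p * (1 / p) = 1"
      using p0 by simp
    moreover have "0 \<le> ces_norm (S m) / real m"
      by (simp add: ces_norm_nonneg)
    ultimately show ?thesis
      by (simp only: powr_powr powr_one) simp
  qed
  ultimately have "(\<lambda>m. 1 / real m * ces_norm (\<lambda>x. \<Sum>k<m. f (r k) x)) \<longlonglongrightarrow> 0"
    by (simp add: S_def[abs_def])
  with r that show ?thesis
    by blast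
qed

text \<open>On the half-line this makes \<open>Ces 1\<close> trivial, and lets both intervals share one argument for \<open>p = 1\<close>.\<close>

lemma weight_one_infinite:
  assumes "J = {0<..}" "0 < t"
  shows "weight (\<lambda>x. 1) t = \<infinity>"
proof -
  have "ennreal (real n) \<le> weight (\<lambda>x. 1) t" for n
  proof -
    \<comment> \<open>Chosen so that the integral of 1 / x over \<open>[t, b]\<close> is exactly
      n.\<close>
    define b where "b = t * exp (real n)"
    have "1 \<le> exp (real n)"
      by simp
    then have b: "t \<le> b"
      using assms(2) by (simp add: b_def)
    have "(\<integral>\<^sup>+x. ennreal (1 / x) * indicator {t..b} x \<partial>lborel) = ennreal (ln b - ln t)"
    proof (rule nn_integral_FTC_Icc)
      fix x assume "x \<in> {t..b}"
      then have x: "0 < x"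
        using assms(2) by auto
      show "DERIV ln x :> 1 / x"
        using x by (auto intro!: derivative_eq_intros)
      show "0 \<le> 1 / x"
        using x by simp
    qed (use b in auto)
    moreover have "ln b - ln t = real n"
      using assms(2) by (simp add: b_def ln_mult)
    moreover have "(\<integral>\<^sup>+x. ennreal (1 / x) * indicator {t..b} x \<partial>lborel) \<le> weight (\<lambda>x. 1) t"
      unfolding weight_def using assms by (intro nn_integral_mono) (auto simp: indicator_def)
    ultimately show ?thesis
      by simp
  qed
  then show ?thesis
    using ennreal_Ex_less_of_nat[of "weight (\<lambda>x. 1) t"]
    by (force simp: not_less[symmetric] ennreal_of_nat_eq_real_of_nat less_top[symmetric])
qed

text \<open>With the constant kernel 1, the Cesaro norm is exactly the integral of |h| against
  \<open>v\<close>. On the unit interval v(t) = ln (1 / t) for 0 < t < 1; on the half-line the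
  weight is infinite and \<open>enn2real\<close> sends it to 0, so \<open>v\<close> vanishes and so
  does the norm. In both cases \<open>[0, 1]\<close> is a support of finite measure, so the
  \<open>L\<^sub>1\<close> result applies to the full norm.\<close>

lemma banach_saks_eq_1:
  assumes p1: "p = 1"
    and f: "\<And>n. borel_rep (f n)"
    and wn: "weakly_null (Ces p I) (\<lambda>n. cls (f n))"
    and M: "\<And>n. ces_norm (f n) \<le> M"
  obtains r where "strict_mono r" "(\<lambda>m. 1 / real m * ces_norm (\<lambda>x. \<Sum>k<m. f (r k) x)) \<longlonglongrightarrow> 0"
proof -
  define v where "v t = indicator J t * enn2real (weight (\<lambda>x. 1) t)" for t
  have [measurable]: "v \<in> borel_measurable borel"
    unfolding v_def[abs_def] by measurable
  have v0: "0 \<le> v t" for t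
    by (simp add: v_def)
  have k: "(\<integral>\<^sup>+x. ennreal (indicator J x * (1 * avg h x)) \<partial>lborel) = ennreal (ces_norm h)" if h: "borel_rep h" for h
  proof -
    have eq: "indicator J x * (1 * avg h x) = indicator J x * avg h x powr p" for x
      using p1 avg_nonneg[of x h] J_pos[of x] by (cases "x \<in> J") auto
    have "(\<integral>x. indicator J x * avg h x powr p \<partial>lborel) = ces_norm h"
      unfolding ces_norm_powr[symmetric] using p1 ces_norm_nonneg[of h] by simp
    then show ?thesis
      unfolding eq by (subst nn_integral_eq_integral[OF borel_rep_avg_integrable[OF h]]) auto
  qed
  have hv: "\<bar>h t\<bar> * v t = \<bar>h t\<bar> * enn2real (weight (\<lambda>x. 1) t)" if "borel_rep h" for h t
    using borel_rep_zero_outside[OF that, of t] by (cases "t \<in> J") (auto simp: v_def)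
  have W: "integrable lborel (\<lambda>t. \<bar>h t\<bar> * v t)" "(\<integral>t. \<bar>h t\<bar> * v t \<partial>lborel) = ces_norm h" if h: "borel_rep h" for h
  proof -
    have le: "(\<integral>\<^sup>+x. ennreal (indicator J x * (1 * avg h x)) \<partial>lborel) \<le> ennreal (1 * ces_norm h)" if "borel_rep h" for h
      using k[OF that] by simp
    have *: "(\<integral>\<^sup>+t. ennreal (\<bar>h t\<bar> * v t) \<partial>lborel) = ennreal (ces_norm h)" "integrable lborel (\<lambda>t. \<bar>h t\<bar> * v t)"
      unfolding hv[OF h] k[OF h, symmetric]
      by (rule weight_functional(1)[OF _ _ le _ h] weight_functional(2)[OF _ _ le _ h]; simp)+
    show "integrable lborel (\<lambda>t. \<bar>h t\<bar> * v t)"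
      by (rule *(2))
    show "(\<integral>t. \<bar>h t\<bar> * v t \<partial>lborel) = ces_norm h"
      using *(1) v0 ces_norm_nonneg[of h]
      by (subst (asm) nn_integral_eq_integral[OF *(2)]) (auto simp: Bochner_Integration.integral_nonneg)
  qed
  have support: "v t = 0" if "t \<notin> {0..1}" for t
    using IJ
  proof
    assume "I = {0..1} \<and> J = {0<..<1}"
    then show ?thesis
      using that by (auto simp: v_def)
  next
    assume "I = {0..} \<and> J = {0<..}"
    then show ?thesis
      using weight_one_infinite[of t] by (cases "0 < t") (auto simp: v_def)
  qed
  have v: "admissible v"
    unfolding admissible_def
  proof (intro conjI allI)
    show "\<exists>C\<ge>0. \<forall>g. borel_rep g \<longrightarrow> integrable lborel (\<lambda>x. \<bar>g x\<bar> * v x) \<and> (\<integral>x. \<bar>g x\<bar> * v x \<partial>lborel) \<le> C * ces_norm g"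
      using W by (intro exI[of _ 1]) auto
    show "\<exists>E\<in>sets lborel. emeasure lborel E < \<infinity> \<and> (\<forall>x. x \<notin> E \<longrightarrow> v x = 0)"
      using support by (intro bexI[of _ "{0..1}"]) (auto simp: emeasure_lborel_Icc_eq)
  qed (simp_all add: v0)
  have "\<exists>\<^sub>F n in sequentially. almost_orthogonal v f xs n" for xs
    by (intro eventually_frequently eventually_almost_orthogonal[OF f wn M v]) simp
  from strict_mono_selection[of "almost_orthogonal v f", OF this] obtain r where r: "strict_mono r"
      and almost_orthogonal: "\<And>k. almost_orthogonal v f (map r [0..<k]) (r k)"
    by blast
  have "(\<lambda>m. (\<integral>x. \<bar>\<Sum>k<m. f (r k) x\<bar> * v x \<partial>lborel) / real m) \<longlonglongrightarrow> 0"
    using almost_orthogonal by (rule weighted_means_tendsto_0[OF f wn M v])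
  then have "(\<lambda>m. 1 / real m * ces_norm (\<lambda>x. \<Sum>k<m. f (r k) x)) \<longlonglongrightarrow> 0"
    by (simp add: W(2) borel_rep_sum f)
  with r that show ?thesis
    by blast
qed

lemma weak_banach_saks_Ces: "weak_banach_saks (Ces p I)"
  unfolding weak_banach_saks_def
proof (intro allI impI)
  fix x assume x: "weakly_null (Ces p I) x"
  have "\<exists>f. borel_rep f \<and> x n = cls f" for n
  proof -
    have "x n \<in> ns_carrier (Ces p I)"
      using x by (simp add: weakly_null_def)
    then show ?thesis
      by (rule borel_rep_representative) blast
  qed
  then obtain f where f: "\<And>n. borel_rep (f n)" "\<And>n. x n = cls (f n)"
    by metis
  obtain M where M: "\<And>n. ns_norm (Ces p I) (x n) \<le> M"
    using weakly_null_imp_norm_bounded[OF x norming_functional] by blast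
  then have M: "ces_norm (f n) \<le> M" for n
    using f by (metis ns_norm_cls)
  have wn: "weakly_null (Ces p I) (\<lambda>n. cls (f n))"
    using x by (simp flip: f(2))
  have "\<exists>r. strict_mono r \<and> (\<lambda>m. 1 / real m * ces_norm (\<lambda>x. \<Sum>k<m. f (r k) x)) \<longlonglongrightarrow> 0"
  proof (cases "p = 1")
    case True
    then show ?thesis
      using banach_saks_eq_1[OF _ f(1) wn M] by blast
  next
    case False
    then have p1: "1 < p"
      using p by simp
    obtain s where s: "strict_mono s" "\<And>x. x \<in> J \<Longrightarrow> convergent (\<lambda>n. cumulative (f (s n)) x)"
      using cumulative_convergent_subsequence[OF f(1) wn M] by blast
    obtain r where r: "strict_mono r" "(\<lambda>m. 1 / real m * ces_norm (\<lambda>x. \<Sum>k<m. f (s (r k)) x)) \<longlonglongrightarrow> 0"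
      using banach_saks_gt_1[OF p1 f(1) weakly_null_subseq[OF wn s(1)] M s(2)] by blast
    have "strict_mono (s \<circ> r)"
      using s(1) r(1) by (rule strict_mono_o)
    with r(2) show ?thesis
      by (intro exI[of _ "s \<circ> r"]) simp
  qed
  then obtain r where r: "strict_mono r" "(\<lambda>m. 1 / real m * ces_norm (\<lambda>x. \<Sum>k<m. f (r k) x)) \<longlonglongrightarrow> 0"
    by blast
  have "ns_norm (Ces p I) (ns_sum (Ces p I) (\<lambda>k. x (r k)) m) = ces_norm (\<lambda>x. \<Sum>k<m. f (r k) x)" for m
    unfolding f(2) by (subst ns_sum_cls[OF f(1)]) (rule ns_norm_cls[OF borel_rep_sum[OF f(1)]])
  with r show "\<exists>r. strict_mono r \<and>
      (\<lambda>m. 1 / real m * ns_norm (Ces p I) (ns_sum (Ces p I) (\<lambda>k. x (r k)) m)) \<longlonglongrightarrow> 0"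
    by auto
qed

end

theorem theorem1:
  fixes p :: real and I :: "real set"
  assumes "1 \<le> p" and "I = {0..1} \<or> I = {0..}"
  shows "weak_banach_saks (Ces p I)"
proof -
  have "cesaro_interval p I (if I = {0..1} then {0<..<1} else {0<..})"
    by standard (use assms in auto)
  then show ?thesis
    by (rule cesaro_interval.weak_banach_saks_Ces)
qed

end
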